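(* Let $H(\mathbf{p})=-\sum_{k=1}^\infty p_k^2$ for $\mathbf{p}=(p_1,p_2,\ldots)\in\bar\nabla$. Let $\alpha(\theta)$ be a real-valued function of $\theta>0$ such that $\lim_{\theta\to\infty}\alpha(\theta)/\theta$ exists and equals $0$, or some $c\in(0,\infty)$, or $\infty$. Define the probability measure $\Xi^H_{\alpha,\theta}$ on $\bar\nabla$ by $$\Xi^H_{\alpha,\theta}(d\mathbf{p})=\frac{e^{\alpha(\theta)H(\mathbf{p})}}{E^{\Xi_\theta}[e^{\alpha(\theta)H(\mathbf{q})}]}\,\Xi_\theta(d\mathbf{p}).$$ Then the family $\{\Xi^H_{\alpha,\theta}\}$ satisfies a large deviation principle on $\bar\nabla$ (as $\theta\to\infty$) with speed $\theta$ and rate function $$S_\alpha(\mathbf{p})=\begin{cases}S(\mathbf{p}), & \text{if }\lim_{\theta\to\infty}\frac{\alpha(\theta)}{\theta}=0,\\ S^c(\mathbf{p}), & \text{if }\lim_{\theta\to\infty}\frac{\alpha(\theta)}{\theta}=c>0,\\ S^\infty(\mathbf{p}), & \text{if }\lim_{\theta\to\infty}\frac{\alpha(\theta)}{\theta}=\infty,\end{cases}$$ where $S^c(\mathbf{p})=\sup_{\mathbf{q}\in\bar\nabla}\{cH(\mathbf{q})-S(\mathbf{q})\}-(cH(\mathbf{p})-S(\mathbf{p}))$, and $S^\infty(\mathbf{p})=0$ if $\mathbf{p}=\mathbf{p}_0$, $S^\infty(\mathbf{p})=\infty$ otherwise, with $\mathbf{p}_0=(0,0,\ldots)$ the unique maximum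 point of $H$ on $\bar\nabla$.
   Context: **Large deviation principle (LDP).** Let $E$ be a complete separable metric space. A family $\{Q_\theta:\theta>0\}$ of probability measures on $E$ satisfies an LDP (as $\theta\to\infty$) with speed $\theta$ and rate function $I:E\to[0,\infty]$ if for every closed $F\subset E$ and every open $G\subset E$, $\limsup_{\theta\to\infty}\frac1\theta\log Q_\theta\{F\}\le-\inf_{x\in F}I(x)$ and $\liminf_{\theta\to\infty}\frac1\theta\log Q_\theta\{G\}\ge-\inf_{x\in G}I(x)$, and for every $c>0$ the set $\{x:I(x)\le c\}$ is compact. (Conventions: $\log 0=-\infty$, $\inf\emptyset=\infty$.) **The Poisson–Dirichlet distribution.** For $\theta>0$, let $U_1,U_2,\ldots$ be i.i.d. with $Beta(1,\theta)$ distribution (density $\theta(1-x)^{\theta-1}$ on $(0,1)$). Put $X_1=U_1$ and $X_k=(1-U_1)\cdots(1-U_{k-1})U_k$ for $k\ge2$. Let $P_k(\theta)$ be the $k$th largest among $X_1,X_2,\ldots$, i.e. $\mathbf{P}(\theta)=(P_1(\theta),P_2(\theta),\ldots)$ is the sequence $(X_k)$ rearranged in descending order. The law of $\mathbf{P}(\theta)$ is the Poisson–Dirichlet distribution $PD(\theta)$. **State space.** $\bar\nabla=\{(p_1,p_2,\ldots):p_1\ge p_2\ge\cdots\ge0,\ \sum_{k=1}^\infty p_k\le1\}$, with the subspace topology inherited from the product topology of $\mathbb{R}^\infty$; it is metrized by $d(\mathbf{p},\mathbf{q})=\sum_{k=1}^\infty|p_k-q_k|/2^k$. $\Xi_\theta$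 denotes the law of $\mathbf{P}(\theta)$ on $\bar\nabla$ and $E^{\Xi_\theta}$ is expectation under $\Xi_\theta$. **The function $S$.** For $\mathbf{p}\in\bar\nabla$, $S(\mathbf{p})=\log\frac1{1-\sum_{k=1}^\infty p_k}$ if $\sum_{k=1}^\infty p_k<1$, and $S(\mathbf{p})=\infty$ otherwise. (When $S(\mathbf{p})=\infty$, $S^c(\mathbf{p})=\infty$.) *)

theory Defs
  imports "HOL-Probability.Probability"
begin

section \<open>Large deviation principles\<close>

definition ereal_ln :: "real \<Rightarrow> ereal" where
  "ereal_ln x = (if x = 0 then -\<infinity> else ereal (ln x))"

text \<open>
  The state space is a subset \<open>E\<close> of a Polish type, carrying the subspace topology; it is
  meant to be used with closed \<open>E\<close>, so that \<open>E\<close> is itself Polish. Only the measures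
  \<open>Q \<theta>\<close> with \<open>\<theta> > 0\<close> and the values of \<open>I\<close> on \<open>E\<close> matter. The infimum over the
  empty set is \<open>\<infinity>\<close> in \<^typ>\<open>ereal\<close>.
\<close>

definition satisfies_LDP ::
  "'a::polish_space set \<Rightarrow> (real \<Rightarrow> 'a measure) \<Rightarrow> ('a \<Rightarrow> ereal) \<Rightarrow> bool" where
  "satisfies_LDP E Q I \<longleftrightarrow>
     (\<forall>\<theta>>0. prob_space (Q \<theta>) \<and> sets (Q \<theta>) = sets (restrict_space borel E)) \<and>
     (\<forall>x\<in>E. 0 \<le> I x) \<and>
     (\<forall>F. closedin (top_of_set E) F \<longrightarrow>
        Limsup at_top (\<lambda>\<theta>. ereal (1 / \<theta>) * ereal_ln (measure (Q \<theta>) F)) \<le> - (INF x\<in>F. I x)) \<and>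
     (\<forall>G. openin (top_of_set E) G \<longrightarrow>
        - (INF x\<in>G. I x) \<le> Liminf at_top (\<lambda>\<theta>. ereal (1 / \<theta>) * ereal_ln (measure (Q \<theta>) G))) \<and>
     (\<forall>c>0. compact {x \<in> E. I x \<le> ereal c})"

section \<open>The state space\<close>

text \<open>
  All sequences are indexed from \<open>0\<close>: \<open>p k\<close> stands for $p_{k+1}$. The topology and the Borel
  sets of the function type \<^typ>\<open>nat \<Rightarrow> real\<close> are those of the product topology.
\<close>

definition nabla :: "(nat \<Rightarrow> real) set" where
  "nabla = {p. decseq p \<and> (\<forall>k. 0 \<le> p k) \<and> summable p \<and> (\<Sum>k. p k) \<le> 1}"

lemma closed_nabla: "closed nabla"
proof -
  have "nabla = (\<Inter>k. {p. p (Suc k) \<le> p k}) \<inter> (\<Inter>k. {p. 0 \<le> p k})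
      \<inter> (\<Inter>n. {p. (\<Sum>k<n. p k) \<le> 1})" (is "_ = ?R")
  proof (intro subset_antisym subsetI)
    fix p assume "p \<in> nabla"
    then show "p \<in> ?R"
      by (auto simp: nabla_def decseq_Suc_iff intro: order_trans[OF sum_le_suminf])
  next
    fix p assume p: "p \<in> ?R"
    have "summable p"
      by (rule summableI_nonneg_bounded[of p 1]) (use p in auto)
    moreover from this have "suminf p \<le> 1"
      by (rule suminf_le_const) (use p in auto)
    ultimately show "p \<in> nabla"
      using p by (auto simp: nabla_def decseq_Suc_iff)
  qed
  moreover have "closed ?R"
    by (intro closed_Int closed_INT ballI closed_Collect_le continuous_intros
        continuous_on_product_coordinates)
  ultimately show ?thesis by simp
qed

section \<open>The Poisson--Dirichlet distribution\<close>

text \<open>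
  \<open>Beta(1, \<theta>)\<close> lives on the open unit interval, not on the whole line. As a consequence every
  (not just almost every) realisation of the sequence of \<open>U\<close>'s has its ranked sequence in
  \<^term>\<open>nabla\<close>.
\<close>

definition beta1 :: "real \<Rightarrow> real measure" where
  "beta1 \<theta> = density (restrict_space lborel {0<..<1})
                     (\<lambda>x. ennreal (\<theta> * (1 - x) powr (\<theta> - 1)))"

definition stick_breaking :: "(nat \<Rightarrow> real) \<Rightarrow> nat \<Rightarrow> real" where
  "stick_breaking u k = (\<Prod>j<k. 1 - u j) * u k"

text \<open>
  The largest value that is reached or exceeded by at least \<open>k + 1\<close> terms of the sequence, i.e.
  ties are counted with multiplicity.
\<close>

definition kth_largest :: "(nat \<Rightarrow> real) \<Rightarrow> nat \<Rightarrow> real" where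
  "kth_largest x k = (SUP A\<in>{A. finite A \<and> card A = Suc k}. Min (x ` A))"

lemma kth_largest_eq_descending_rearrangement:
  assumes \<sigma>: "bij \<sigma>" and dec: "decseq (x \<circ> \<sigma>)"
  shows "kth_largest x = x \<circ> \<sigma>"
proof
  fix k
  have "kth_largest x k = x (\<sigma> k)"
    unfolding kth_largest_def
  proof (rule cSup_eq_maximum)
    have "Min (x ` \<sigma> ` {..k}) = x (\<sigma> k)"
      using dec by (intro Min_eqI) (auto simp: decseq_def)
    moreover have "card (\<sigma> ` {..k}) = Suc k"
      using \<sigma> by (subst card_image) (auto intro: inj_on_subset bij_is_inj)
    ultimately show "x (\<sigma> k) \<in> (\<lambda>A. Min (x ` A)) ` {A. finite A \<and> card A = Suc k}"
      by (intro image_eqI[of _ _ "\<sigma> ` {..k}"]) auto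
  next
    fix y assume "y \<in> (\<lambda>A. Min (x ` A)) ` {A. finite A \<and> card A = Suc k}"
    then obtain A where A: "finite A" "card A = Suc k" "y = Min (x ` A)" by auto
    have "\<not> A \<subseteq> \<sigma> ` {..<k}"
    proof
      assume "A \<subseteq> \<sigma> ` {..<k}"
      then have "card A \<le> card (\<sigma> ` {..<k})" by (intro card_mono) auto
      also have "\<dots> \<le> k" using card_image_le[of "{..<k}" \<sigma>] by simp
      finally show False using A by simp
    qed
    then obtain a where a: "a \<in> A" "a \<notin> \<sigma> ` {..<k}" by blast
    obtain j where j: "a = \<sigma> j" using \<sigma> by (metis bij_pointE)
    with a have "k \<le> j" by (metis imageI lessThan_iff not_le)
    then have "x a \<le> x (\<sigma> k)" using dec j by (auto simp: decseq_def)
    moreover have "y \<le> x a" using A a by simp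
    ultimately show "y \<le> x (\<sigma> k)" by simp
  qed
  then show "kth_largest x k = (x \<circ> \<sigma>) k" by simp
qed

definition PD :: "real \<Rightarrow> (nat \<Rightarrow> real) measure" where
  "PD \<theta> = distr (PiM UNIV (\<lambda>_::nat. beta1 \<theta>)) (restrict_space borel nabla)
                 (\<lambda>u. kth_largest (stick_breaking u))"

section \<open>Selection and the rate functions\<close>

definition H :: "(nat \<Rightarrow> real) \<Rightarrow> real" where
  "H p = - (\<Sum>k. (p k)\<^sup>2)"

definition PD_H :: "real \<Rightarrow> real \<Rightarrow> (nat \<Rightarrow> real) measure" where
  "PD_H a \<theta> = density (PD \<theta>)
     (\<lambda>p. ennreal (exp (a * H p) / (\<integral>q. exp (a * H q) \<partial>PD \<theta>)))"

definition S :: "(nat \<Rightarrow> real) \<Rightarrow> ereal" where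
  "S p = (if (\<Sum>k. p k) < 1 then ereal (ln (1 / (1 - (\<Sum>k. p k)))) else \<infinity>)"

definition S_fin :: "real \<Rightarrow> (nat \<Rightarrow> real) \<Rightarrow> ereal" where
  "S_fin c p = (SUP q\<in>nabla. ereal (c * H q) - S q) - (ereal (c * H p) - S p)"

definition S_inf :: "(nat \<Rightarrow> real) \<Rightarrow> ereal" where
  "S_inf p = (if p = (\<lambda>_. 0) then 0 else \<infinity>)"

text \<open>The argument \<open>L\<close> is the limit of \<open>\<alpha>(\<theta>) / \<theta>\<close> in \<open>[0, \<infinity>]\<close>.\<close>

definition S_rate :: "ereal \<Rightarrow> (nat \<Rightarrow> real) \<Rightarrow> ereal" where
  "S_rate L = (if L = 0 then S else if L = \<infinity> then S_inf else S_fin (real_of_ereal L))"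

end

theory Submission
  imports Defs
begin

text \<open>
  The state space is compact in the product topology, so the large deviation principle reduces to
  estimates of the mass of neighbourhoods of single points (\<open>LDP_of_local_rate\<close>).

  The two estimates for the Poisson--Dirichlet law itself come from its stick-breaking
  construction. After one break a stick of length \<open>w\<close> becomes a stick of length \<open>w * (1 - x)\<close> with
  independent fresh fractions, and functions of the form \<open>(1 - T / w) powr (\<theta> - 1)\<close> behave well
  under this step, because the rescaled power cancels against the density of \<open>Beta(1, \<theta>)\<close>. Here \<open>T\<close>
  is the mass that the pieces still have to provide. By induction over the breaks, distinct pieces
  above given thresholds with sum \<open>T\<close> have probability at most a constant times
  \<open>(1 - T) powr (\<theta> - 1)\<close> (\<open>emeasure_hits_le\<close>), and the first pieces follow a given finite sequence
  with sum \<open>T\<close>, all others being negligible, with about this probability as well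
  (\<open>emeasure_tracks_ge\<close>). Ranking the pieces is nonexpansive in the supremum norm, so both
  estimates pass to the ranked sequence. The rate at \<open>p\<close> is therefore \<open>- ln (1 - suminf p) = S p\<close>
  (\<open>has_local_rate_PD\<close>).

  The tilted measure is handled by the usual change of measure. The function \<open>H\<close> is continuous on
  the state space, since entry number \<open>k\<close> of a ranked sequence is at most \<open>1 / (k + 1)\<close>, and
  attains its maximum \<open>0\<close> only at the zero sequence, where also \<open>S\<close> vanishes. So the normalising
  constant has exponential rate \<open>0\<close>, and if \<open>\<alpha> \<theta> / \<theta>\<close> tends to a finite \<open>c\<close>, tilting just shifts the
  local rate to \<open>S p - c * H p\<close>. If \<open>\<alpha> \<theta> / \<theta>\<close> tends to infinity, any set on which \<open>H\<close> is bounded away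
  from \<open>0\<close> has superexponentially small mass, and everything concentrates at the zero sequence.
\<close>

section \<open>From local estimates to a large deviation principle\<close>

text \<open>
  On a compact space a large deviation principle is a local matter: it suffices to estimate the mass
  of a small neighbourhood of each point from above, and the mass of every neighbourhood from below.
  Stating the two estimates with a real rate \<open>M\<close> on either side of \<open>I p\<close>
  makes infinite values of \<open>I\<close> unproblematic: they satisfy the second estimate
  vacuously.
\<close>

definition has_local_rate ::
  "'a::topological_space set \<Rightarrow> (real \<Rightarrow> 'a measure) \<Rightarrow> ('a \<Rightarrow> ereal) \<Rightarrow> bool" where
  "has_local_rate E Q I \<longleftrightarrow> (\<forall>p\<in>E. \<forall>M::real.
     (ereal M < I p \<longrightarrow> (\<exists>U. open U \<and> p \<in> U \<and>
        (\<forall>\<^sub>F \<theta> in at_top. measure (Q \<theta>) (U \<inter> E) \<le> exp (- (\<theta> * M))))) \<and>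
     (I p < ereal M \<longrightarrow> (\<forall>U. open U \<longrightarrow> p \<in> U \<longrightarrow>
        (\<forall>\<^sub>F \<theta> in at_top. exp (- (\<theta> * M)) \<le> measure (Q \<theta>) (U \<inter> E)))))"

lemma has_local_rateD_upper:
  assumes "has_local_rate E Q I" "p \<in> E" "ereal M < I p"
  obtains U where "open U" "p \<in> U"
    "\<forall>\<^sub>F \<theta> in at_top. measure (Q \<theta>) (U \<inter> E) \<le> exp (- (\<theta> * M))"
  using assms unfolding has_local_rate_def by blast

lemma has_local_rateD_lower:
  assumes "has_local_rate E Q I" "p \<in> E" "I p < ereal M" "open U" "p \<in> U"
  shows "\<forall>\<^sub>F \<theta> in at_top. exp (- (\<theta> * M)) \<le> measure (Q \<theta>) (U \<inter> E)"
  using assms unfolding has_local_rate_def by blast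

lemma scaled_ereal_ln_le:
  assumes "0 < \<theta>" "0 \<le> x" "x \<le> exp (- (\<theta> * M))"
  shows "ereal (1 / \<theta>) * ereal_ln x \<le> ereal (- M)"
proof (cases "x = 0")
  case True
  then show ?thesis using assms by (simp add: ereal_ln_def)
next
  case False
  then have "ln x \<le> - (\<theta> * M)"
    using assms by (subst exp_le_cancel_iff[symmetric]) simp
  then show ?thesis using assms False by (simp add: ereal_ln_def field_simps)
qed

lemma le_scaled_ereal_ln:
  assumes "0 < \<theta>" "exp (- (\<theta> * M)) \<le> x"
  shows "ereal (- M) \<le> ereal (1 / \<theta>) * ereal_ln x"
proof -
  have "0 < x" using less_le_trans[OF exp_gt_zero assms(2)] .
  then have "- (\<theta> * M) \<le> ln x"
    using assms by (simp add: ln_ge_iff)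
  then show ?thesis using assms \<open>0 < x\<close> by (simp add: ereal_ln_def field_simps)
qed

text \<open>
  Constant factors cost an arbitrarily small part of an exponential rate.
\<close>

lemma eventually_mult_exp_le_exp:
  fixes C M M' :: real
  assumes "M' < M"
  shows "\<forall>\<^sub>F \<theta> in at_top. C * exp (- (\<theta> * M)) \<le> exp (- (\<theta> * M'))"
proof -
  have "filterlim (\<lambda>\<theta>. \<theta> * (M - M')) at_top at_top"
    using assms filterlim_at_top_mult_tendsto_pos[OF tendsto_const, of "M - M'" "\<lambda>x. x"]
    by (simp add: filterlim_ident mult.commute)
  then have "filterlim (\<lambda>\<theta>. exp (\<theta> * (M - M'))) at_top at_top"
    by (rule filterlim_compose[OF exp_at_top])
  then have "\<forall>\<^sub>F \<theta> in at_top. C \<le> exp (\<theta> * (M - M'))"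
    by (simp add: filterlim_at_top)
  then show ?thesis
  proof eventually_elim
    case (elim \<theta>)
    then have "C * exp (- (\<theta> * M)) \<le> exp (\<theta> * (M - M')) * exp (- (\<theta> * M))"
      by (intro mult_right_mono) auto
    also have "\<dots> = exp (- (\<theta> * M'))"
      by (simp add: exp_add[symmetric] algebra_simps)
    finally show ?case .
  qed
qed

text \<open>
  The upper bound on a closed set follows from a finite cover by neighbourhoods with good upper
  estimates, the lower bound on an open set from the lower estimate at each of its points.
  Nonnegativity and compact level sets come for free: a negative value of \<open>I\<close> would
  force mass above \<open>1\<close>, and if points with \<open>I \<le> c\<close> accumulated at a
  point with \<open>I > c\<close>, their lower estimates would contradict the upper estimate in a
  common neighbourhood.
\<close>

lemma LDP_of_local_rate:
  fixes Q :: "real \<Rightarrow> 'a::polish_space measure"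
  assumes E: "compact E"
    and prob: "\<And>\<theta>. 0 < \<theta> \<Longrightarrow> prob_space (Q \<theta>)"
    and sets: "\<And>\<theta>. 0 < \<theta> \<Longrightarrow> sets (Q \<theta>) = sets (restrict_space borel E)"
    and local_rate: "has_local_rate E Q I"
  shows "satisfies_LDP E Q I"
  unfolding satisfies_LDP_def
proof (intro conjI allI impI ballI)
  fix \<theta> :: real assume "0 < \<theta>"
  then show "prob_space (Q \<theta>)" "sets (Q \<theta>) = sets (restrict_space borel E)"
    using prob sets by auto
next
  have pos: "\<forall>\<^sub>F \<theta>::real in at_top. 0 < \<theta>" by (rule eventually_gt_at_top)
  have sets_Int: "U \<inter> E \<in> sets (Q \<theta>)" if "open U" "0 < \<theta>" for U \<theta>
    using that by (auto simp: sets sets_restrict_space)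
  {
    fix p assume p: "p \<in> E"
    show "0 \<le> I p"
    proof (rule ccontr)
      assume "\<not> 0 \<le> I p"
      then obtain M where M: "I p < ereal M" "ereal M < 0"
        using ereal_dense2 by (metis not_le)
      have "\<forall>\<^sub>F \<theta> in at_top. exp (- (\<theta> * M)) \<le> measure (Q \<theta>) (UNIV \<inter> E)"
        using has_local_rateD_lower[OF local_rate p M(1), of UNIV] by simp
      then have "\<forall>\<^sub>F \<theta>::real in at_top. False"
        using pos
      proof eventually_elim
        case (elim \<theta>)
        interpret prob_space "Q \<theta>" using elim prob by simp
        have "exp (- (\<theta> * M)) \<le> 1" using elim prob_le_1 order_trans by blast
        moreover have "\<theta> * M < 0" using elim M by (simp add: mult_pos_neg)
        ultimately show ?case by simp
      qed
      then show False by simp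
    qed
  }
  {
    fix F assume F: "closedin (top_of_set E) F"
    then have FE: "F \<subseteq> E" using closedin_subset by fastforce
    have "compact F" using F E closedin_compact by blast
    have "Limsup at_top (\<lambda>\<theta>. ereal (1 / \<theta>) * ereal_ln (measure (Q \<theta>) F)) \<le> y"
      if y: "- (INF x\<in>F. I x) < y" for y
    proof -
      have "- y < (INF x\<in>F. I x)" using y by (simp add: ereal_uminus_less_reorder)
      then obtain M' where M': "- y < ereal M'" "ereal M' < (INF x\<in>F. I x)"
        using ereal_dense2 by blast
      \<comment> \<open>The room between \<open>M'\<close> and \<open>M\<close> absorbs the number of sets in the finite cover.\<close>
      then obtain M where M: "ereal M' < ereal M" "ereal M < (INF x\<in>F. I x)"
        using ereal_dense2 by blast
      have "\<exists>U. open U \<and> p \<in> U \<and>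
          (\<forall>\<^sub>F \<theta> in at_top. measure (Q \<theta>) (U \<inter> E) \<le> exp (- (\<theta> * M)))" if "p \<in> F" for p
      proof -
        have "ereal M < I p" using M(2) that by (meson INF_lower less_le_trans)
        then show ?thesis using has_local_rateD_upper[OF local_rate] that FE by blast
      qed
      then obtain U where U: "\<And>p. p \<in> F \<Longrightarrow> open (U p)" "\<And>p. p \<in> F \<Longrightarrow> p \<in> U p"
        "\<And>p. p \<in> F \<Longrightarrow> \<forall>\<^sub>F \<theta> in at_top. measure (Q \<theta>) (U p \<inter> E) \<le> exp (- (\<theta> * M))"
        by metis
      obtain D where D: "D \<subseteq> F" "finite D" "F \<subseteq> (\<Union>p\<in>D. U p)"
        by (rule compactE_image[OF \<open>compact F\<close>, of F U]) (use U in auto)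
      have "\<forall>\<^sub>F \<theta> in at_top. \<forall>p\<in>D. measure (Q \<theta>) (U p \<inter> E) \<le> exp (- (\<theta> * M))"
        using D U(3) by (intro eventually_ball_finite) auto
      moreover have "\<forall>\<^sub>F \<theta> in at_top. real (card D) * exp (- (\<theta> * M)) \<le> exp (- (\<theta> * M'))"
        using M by (intro eventually_mult_exp_le_exp) auto
      ultimately have "\<forall>\<^sub>F \<theta> in at_top. ereal (1 / \<theta>) * ereal_ln (measure (Q \<theta>) F) \<le> ereal (- M')"
        using pos
      proof eventually_elim
        case (elim \<theta>)
        interpret prob_space "Q \<theta>" using elim prob by simp
        have "measure (Q \<theta>) F \<le> measure (Q \<theta>) (\<Union>p\<in>D. U p \<inter> E)"
          using D FE U elim by (intro finite_measure_mono) (auto intro!: sets_Int open_UN)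
        also have "\<dots> \<le> (\<Sum>p\<in>D. measure (Q \<theta>) (U p \<inter> E))"
          using D U elim by (intro finite_measure_subadditive_finite) (auto intro!: sets_Int)
        also have "\<dots> \<le> real (card D) * exp (- (\<theta> * M))"
          using elim by (intro sum_bounded_above) auto
        also have "\<dots> \<le> exp (- (\<theta> * M'))" using elim by simp
        finally show ?case using elim by (intro scaled_ereal_ln_le) auto
      qed
      then have "Limsup at_top (\<lambda>\<theta>. ereal (1 / \<theta>) * ereal_ln (measure (Q \<theta>) F)) \<le> ereal (- M')"
        by (rule Limsup_bounded)
      also have "ereal (- M') \<le> y" using M'(1) by (cases y) auto
      finally show ?thesis .
    qed
    then show "Limsup at_top (\<lambda>\<theta>. ereal (1 / \<theta>) * ereal_ln (measure (Q \<theta>) F)) \<le> - (INF x\<in>F. I x)"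
      by (rule dense_ge)
  }
  {
    fix G assume G: "openin (top_of_set E) G"
    then obtain U where U: "open U" "G = U \<inter> E" by (auto simp: openin_open)
    have "- I p \<le> Liminf at_top (\<lambda>\<theta>. ereal (1 / \<theta>) * ereal_ln (measure (Q \<theta>) G))"
      if p: "p \<in> G" for p
    proof (rule dense_le)
      fix y assume "y < - I p"
      then have "I p < - y" by (simp add: ereal_less_uminus_reorder)
      then obtain M where M: "I p < ereal M" "ereal M < - y" using ereal_dense2 by blast
      have "\<forall>\<^sub>F \<theta> in at_top. exp (- (\<theta> * M)) \<le> measure (Q \<theta>) (U \<inter> E)"
        using p U M by (intro has_local_rateD_lower[OF local_rate]) auto
      then have "\<forall>\<^sub>F \<theta> in at_top. ereal (- M) \<le> ereal (1 / \<theta>) * ereal_ln (measure (Q \<theta>) G)"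
        using pos by eventually_elim (simp add: le_scaled_ereal_ln U)
      then have "ereal (- M) \<le> Liminf at_top (\<lambda>\<theta>. ereal (1 / \<theta>) * ereal_ln (measure (Q \<theta>) G))"
        by (rule Liminf_bounded)
      moreover have "y \<le> ereal (- M)" using M(2) by (cases y) auto
      ultimately show "y \<le> Liminf at_top (\<lambda>\<theta>. ereal (1 / \<theta>) * ereal_ln (measure (Q \<theta>) G))"
        by simp
    qed
    then show "- (INF x\<in>G. I x) \<le> Liminf at_top (\<lambda>\<theta>. ereal (1 / \<theta>) * ereal_ln (measure (Q \<theta>) G))"
      by (simp only: ereal_SUP_uminus_eq[symmetric]) (rule SUP_least)
  }
  {
    fix c :: real
    have "openin (top_of_set E) {x \<in> E. \<not> I x \<le> ereal c}"
    proof (subst openin_subopen, intro ballI)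
      fix p assume "p \<in> {x \<in> E. \<not> I x \<le> ereal c}"
      then have p: "p \<in> E" "ereal c < I p" by auto
      then obtain M where M: "ereal c < ereal M" "ereal M < I p" using ereal_dense2 by blast
      obtain U where U: "open U" "p \<in> U"
        "\<forall>\<^sub>F \<theta> in at_top. measure (Q \<theta>) (U \<inter> E) \<le> exp (- (\<theta> * M))"
        using has_local_rateD_upper[OF local_rate p(1) M(2)] by blast
      have "\<not> I q \<le> ereal c" if q: "q \<in> U \<inter> E" for q
      proof
        assume "I q \<le> ereal c"
        moreover obtain M' where M': "c < M'" "M' < M" using M dense by auto
        ultimately have "I q < ereal M'" by (meson le_less_trans ereal_less_eq(3) less_ereal.simps(1))
        then have "\<forall>\<^sub>F \<theta> in at_top. exp (- (\<theta> * M')) \<le> measure (Q \<theta>) (U \<inter> E)"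
          using q U by (intro has_local_rateD_lower[OF local_rate, of q]) auto
        then have "\<forall>\<^sub>F \<theta>::real in at_top. False"
          using U(3) pos
        proof eventually_elim
          case (elim \<theta>)
          then have "exp (- (\<theta> * M')) \<le> exp (- (\<theta> * M))" by linarith
          then show ?case using elim M' by simp
        qed
        then show False by simp
      qed
      then show "\<exists>T. openin (top_of_set E) T \<and> p \<in> T \<and> T \<subseteq> {x \<in> E. \<not> I x \<le> ereal c}"
        using U p by (intro exI[of _ "U \<inter> E"]) (auto simp: openin_open)
    qed
    moreover have "E - {x \<in> E. I x \<le> ereal c} = {x \<in> E. \<not> I x \<le> ereal c}" by auto
    ultimately have "closedin (top_of_set E) {x \<in> E. I x \<le> ereal c}"
      by (simp add: closedin_def Collect_restrict)
    then show "compact {x \<in> E. I x \<le> ereal c}" using E closedin_compact by blast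
  }
qed

section \<open>Ranking the pieces of a stick\<close>

text \<open>
  Above any positive level there are only finitely many terms, so the largest term outside a finite
  set of indices exists; picking such maxima greedily enumerates all indices, because an index that
  is never picked would have infinitely many terms above its own.
\<close>

lemma ex_descending_rearrangement:
  fixes x :: "nat \<Rightarrow> real"
  assumes pos: "\<And>k. 0 < x k" and lim: "x \<longlonglongrightarrow> 0"
  obtains \<sigma> where "bij \<sigma>" "decseq (x \<circ> \<sigma>)"
proof -
  have fin: "finite {j. x i \<le> x j}" for i
  proof -
    obtain N where "\<forall>j\<ge>N. x j < x i"
      using order_tendstoD(2)[OF lim pos[of i]] by (auto simp: eventually_sequentially)
    then have "{j. x i \<le> x j} \<subseteq> {..<N}" by (auto simp: not_less[symmetric])
    then show ?thesis by (rule finite_subset) simp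
  qed
  have "\<exists>m. m \<notin> A \<and> (\<forall>j. j \<notin> A \<longrightarrow> x j \<le> x m)" if A: "finite A" for A
  proof -
    obtain i where i: "i \<notin> A" using A by (meson ex_new_if_finite infinite_UNIV_nat)
    let ?B = "{j. x i \<le> x j} - A"
    have B: "finite ?B" "?B \<noteq> {}" using fin i by auto
    have "Max (x ` ?B) \<in> x ` ?B" using B by (intro Max_in) auto
    then obtain m where "m \<in> ?B" "Max (x ` ?B) = x m" by blast
    then have m: "m \<in> ?B" "\<And>j. j \<in> ?B \<Longrightarrow> x j \<le> x m"
      using B(1) Max_ge[of "x ` ?B"] by auto
    have "x j \<le> x m" if "j \<notin> A" for j
      using m that by (cases "x i \<le> x j") fastforce+
    then show ?thesis using m by blast
  qed
  then obtain pick where pick: "\<And>A. finite A \<Longrightarrow> pick A \<notin> A"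
    "\<And>A j. finite A \<Longrightarrow> j \<notin> A \<Longrightarrow> x j \<le> x (pick A)"
    by metis
  define T where "T k = ((\<lambda>A. insert (pick A) A) ^^ k) {}" for k
  define \<sigma> where "\<sigma> k = pick (T k)" for k
  have T_Suc: "T (Suc k) = insert (\<sigma> k) (T k)" for k by (simp add: T_def \<sigma>_def)
  have T_eq: "T k = \<sigma> ` {..<k}" for k
    by (induction k) (simp_all add: T_Suc lessThan_Suc, simp add: T_def)
  have T_fin: "finite (T k)" for k by (simp add: T_eq)
  have "inj \<sigma>"
  proof (rule linorder_injI)
    fix i k :: nat assume "i < k"
    then have "\<sigma> i \<in> T k" by (auto simp: T_eq)
    then show "\<sigma> i \<noteq> \<sigma> k" using pick(1)[OF T_fin, of k] by (auto simp: \<sigma>_def)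
  qed
  moreover have "surj \<sigma>"
  proof (rule ccontr)
    assume "\<not> surj \<sigma>"
    then obtain j where j: "j \<notin> range \<sigma>" by blast
    have "x j \<le> x (\<sigma> k)" for k
      unfolding \<sigma>_def using j by (intro pick(2) T_fin) (auto simp: T_eq)
    then have "range \<sigma> \<subseteq> {i. x j \<le> x i}" by auto
    then have "finite (range \<sigma>)" using fin finite_subset by blast
    then show False using \<open>inj \<sigma>\<close> finite_imageD infinite_UNIV_nat by blast
  qed
  moreover have "decseq (x \<circ> \<sigma>)"
  proof (rule decseq_SucI)
    fix k
    have "\<sigma> (Suc k) \<notin> T k"
      using pick(1)[OF T_fin, of "Suc k"] by (simp add: T_Suc[of k]) (simp add: \<sigma>_def T_Suc)
    then show "(x \<circ> \<sigma>) (Suc k) \<le> (x \<circ> \<sigma>) k"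
      using pick(2)[OF T_fin, of "\<sigma> (Suc k)" k] by (simp add: \<sigma>_def)
  qed
  ultimately show ?thesis using that by (simp add: bij_def)
qed

lemma kth_largest_in_nabla:
  assumes pos: "\<And>k. 0 < x k" and sum: "summable x" "suminf x \<le> 1"
  shows "kth_largest x \<in> nabla"
proof -
  obtain \<sigma> where \<sigma>: "bij \<sigma>" "decseq (x \<circ> \<sigma>)"
    using ex_descending_rearrangement[OF pos summable_LIMSEQ_zero[OF sum(1)]] by blast
  have eq: "kth_largest x = x \<circ> \<sigma>" by (rule kth_largest_eq_descending_rearrangement[OF \<sigma>])
  have bound: "(\<Sum>k<n. (x \<circ> \<sigma>) k) \<le> 1" for n
  proof -
    have "(\<Sum>k<n. (x \<circ> \<sigma>) k) = sum x (\<sigma> ` {..<n})"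
      using \<sigma>(1) by (subst sum.reindex) (auto intro: inj_on_subset bij_is_inj)
    also have "\<dots> \<le> suminf x"
      using pos by (intro sum_le_suminf sum(1)) (auto simp: less_imp_le)
    finally show ?thesis using sum by simp
  qed
  have nonneg: "0 \<le> (x \<circ> \<sigma>) k" for k using pos[of "\<sigma> k"] by simp
  have "summable (x \<circ> \<sigma>)" by (rule summableI_nonneg_bounded[OF nonneg bound])
  then show ?thesis
    unfolding nabla_def eq using \<sigma>(2) nonneg suminf_le_const bound by blast
qed

lemma stick_breaking_pos:
  assumes "\<And>k. u k \<in> {0<..<1}"
  shows "0 < stick_breaking u k"
  using assms by (auto simp: stick_breaking_def intro!: mult_pos_pos prod_pos)

lemma sum_stick_breaking: "(\<Sum>k<n. stick_breaking u k) = 1 - (\<Prod>k<n. 1 - u k)"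
  by (induction n) (simp_all add: stick_breaking_def algebra_simps)

lemma stick_breaking_summable:
  assumes "\<And>k. u k \<in> {0<..<1}"
  shows "summable (stick_breaking u)" "suminf (stick_breaking u) \<le> 1"
proof -
  have bound: "(\<Sum>k<n. stick_breaking u k) \<le> 1" for n
    unfolding sum_stick_breaking using assms by (auto intro!: prod_nonneg simp: less_imp_le)
  show "summable (stick_breaking u)"
    using stick_breaking_pos[OF assms] by (intro summableI_nonneg_bounded[OF _ bound]) (simp add: less_imp_le)
  then show "suminf (stick_breaking u) \<le> 1"
    by (rule suminf_le_const) (rule bound)
qed

lemma stick_breaking_le_1:
  assumes "\<And>k. u k \<in> {0<..<1}"
  shows "stick_breaking u k \<le> 1"
  using sum_le_suminf[OF stick_breaking_summable(1)[OF assms], of "{k}"] stick_breaking_summable(2)[OF assms]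
    stick_breaking_pos[OF assms] by (simp add: less_imp_le) (meson order_trans)

lemma Min_image_le:
  assumes "finite A" "A \<noteq> {}" "\<And>j. j \<in> A \<Longrightarrow> y j \<le> (B :: real)"
  shows "Min (y ` A) \<le> B"
  using assms by (metis Min_le finite_imageI image_eqI order_trans ex_in_conv)

lemma card_Suc_nonempty: "card A = Suc k \<Longrightarrow> A \<noteq> {}"
  by auto

lemma bdd_above_kth_largest:
  assumes "\<And>j. y j \<le> (B :: real)"
  shows "bdd_above ((\<lambda>A. Min (y ` A)) ` {A. finite A \<and> card A = Suc k})"
  using assms by (intro bdd_aboveI2[of _ _ B]) (auto intro!: Min_image_le dest: card_Suc_nonempty)

text \<open>
  Ranking is monotone and commutes with adding a constant, hence nonexpansive in the supremum norm.
  This is what turns control of the unordered pieces into control of the ranked ones.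
\<close>

lemma kth_largest_le_add:
  assumes le: "\<And>j. x j \<le> y j + d" and bdd: "\<And>j. y j \<le> B"
  shows "kth_largest x k \<le> kth_largest y k + d"
  unfolding kth_largest_def
proof (rule cSUP_least)
  show "{A. finite A \<and> card A = Suc k} \<noteq> ({} :: nat set set)"
    using card_atMost[of k] finite_atMost by blast
next
  fix A :: "nat set" assume "A \<in> {A. finite A \<and> card A = Suc k}"
  then have A: "finite A" "card A = Suc k" by auto
  then have "A \<noteq> {}" by auto
  have "Min (x ` A) - d \<le> Min (y ` A)"
  proof (rule Min.boundedI)
    fix b assume "b \<in> y ` A"
    then obtain a where "a \<in> A" "b = y a" by blast
    moreover have "Min (x ` A) \<le> x a" using A \<open>a \<in> A\<close> by (intro Min_le) auto
    ultimately show "Min (x ` A) - d \<le> b" using le[of a] by linarith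
  qed (use A \<open>A \<noteq> {}\<close> in auto)
  also have "\<dots> \<le> (SUP A\<in>{A. finite A \<and> card A = Suc k}. Min (y ` A))"
    using A by (intro cSUP_upper bdd_above_kth_largest[OF bdd]) auto
  finally show "Min (x ` A) \<le> (SUP A\<in>{A. finite A \<and> card A = Suc k}. Min (y ` A)) + d" by simp
qed

lemma kth_largest_decseq: "decseq p \<Longrightarrow> kth_largest p = p"
  using kth_largest_eq_descending_rearrangement[of id p] by simp

lemma kth_largest_near_decseq:
  assumes near: "\<And>j. \<bar>x j - p j\<bar> \<le> d" and p: "decseq p" "\<And>j. 0 \<le> p j"
  shows "\<bar>kth_largest x k - p k\<bar> \<le> d"
proof -
  have pB: "p j \<le> p 0" for j using p by (simp add: decseq_def)
  have xB: "x j \<le> p 0 + d" for j using near[of j] pB[of j] by simp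
  have "kth_largest x k \<le> kth_largest p k + d"
    by (rule kth_largest_le_add[OF _ pB]) (use near in \<open>smt (verit)\<close>)
  moreover have "kth_largest p k \<le> kth_largest x k + d"
    by (rule kth_largest_le_add[OF _ xB]) (use near in \<open>smt (verit)\<close>)
  ultimately show ?thesis using kth_largest_decseq[OF p(1)] by simp
qed

section \<open>Compactness of the state space and continuity of H\<close>

text \<open>
  In the product topology the state space is a closed subset of the cube \<open>[0,
  1]\<^sup>\<infinity>\<close>, which is compact by Tychonoff.
\<close>

lemma compact_nabla: "compact nabla"
proof -
  have "compactin (product_topology (\<lambda>_::nat. euclidean) UNIV) (PiE UNIV (\<lambda>_. {0..1::real}))"
    by (subst compactin_PiE) auto
  then have "compact (PiE UNIV (\<lambda>_::nat. {0..1::real}))"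
    by (simp add: euclidean_product_topology)
  moreover have "nabla \<subseteq> PiE UNIV (\<lambda>_. {0..1})"
  proof
    fix p assume p: "p \<in> nabla"
    have "p k \<le> 1" for k
      using p sum_le_suminf[of p "{k}"] by (auto simp: nabla_def)
    then show "p \<in> PiE UNIV (\<lambda>_. {0..1})" using p by (auto simp: nabla_def)
  qed
  ultimately show ?thesis
    using closed_nabla by (metis compact_Int_closed inf.absorb_iff2 inf_commute)
qed

text \<open>
  The first \<open>k + 1\<close> entries of a ranked sequence are at least its entry number
  \<open>k\<close> and sum to at most \<open>1\<close>. The resulting bound is square summable and
  independent of the sequence, which makes \<open>H\<close> continuous even though the total mass is
  not.
\<close>

lemma nabla_le_inverse:
  assumes "p \<in> nabla"
  shows "p k \<le> 1 / real (Suc k)"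
proof -
  have "real (Suc k) * p k = (\<Sum>j<Suc k. p k)" by simp
  also have "\<dots> \<le> (\<Sum>j<Suc k. p j)"
    using assms by (intro sum_mono) (auto simp: nabla_def decseq_def)
  also have "\<dots> \<le> suminf p" using assms by (intro sum_le_suminf) (auto simp: nabla_def)
  also have "\<dots> \<le> 1" using assms by (simp add: nabla_def)
  finally show ?thesis by (simp add: field_simps)
qed

lemma summable_inverse_squares: "summable (\<lambda>k. (1 / real (Suc k))\<^sup>2)"
  using inverse_power_summable[of 2, where 'a = real]
  by (subst summable_Suc_iff) (simp add: power_one_over inverse_eq_divide)

lemma nabla_square_le:
  assumes "p \<in> nabla"
  shows "(p k)\<^sup>2 \<le> (1 / real (Suc k))\<^sup>2"
  using nabla_le_inverse[OF assms, of k] assms by (intro power_mono) (auto simp: nabla_def)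

lemma summable_nabla_squares: "p \<in> nabla \<Longrightarrow> summable (\<lambda>k. (p k)\<^sup>2)"
  by (rule summable_comparison_test'[OF summable_inverse_squares, of 0])
    (simp only: real_norm_def abs_power2 nabla_square_le)

lemma continuous_on_H: "continuous_on nabla H"
proof -
  have "uniform_limit nabla (\<lambda>n p. \<Sum>k<n. (p k)\<^sup>2) (\<lambda>p. \<Sum>k. (p k)\<^sup>2) sequentially"
    by (rule Weierstrass_m_test[OF _ summable_inverse_squares])
      (simp only: real_norm_def abs_power2 nabla_square_le)
  then have "continuous_on nabla (\<lambda>p. \<Sum>k. (p k)\<^sup>2)"
    by (rule uniform_limit_theorem[rotated])
      (auto intro!: always_eventually continuous_on_sum continuous_on_power
        continuous_on_subset[OF continuous_on_product_coordinates])
  then show ?thesis unfolding H_def[abs_def] by (rule continuous_on_minus)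
qed

lemma H_le_0: "p \<in> nabla \<Longrightarrow> H p \<le> 0"
  by (simp add: H_def suminf_nonneg summable_nabla_squares)

lemma H_ge_minus_1:
  assumes p: "p \<in> nabla"
  shows "- 1 \<le> H p"
proof -
  have "(p k)\<^sup>2 \<le> p k" for k
  proof -
    have "p k \<le> 1" using nabla_le_inverse[OF p, of k] by (rule order_trans) simp
    then show ?thesis using p by (simp add: nabla_def power2_eq_square mult_left_le)
  qed
  then have "(\<Sum>k. (p k)\<^sup>2) \<le> suminf p"
    using p by (intro suminf_le summable_nabla_squares) (auto simp: nabla_def)
  then show ?thesis using p by (simp add: H_def nabla_def)
qed

lemma H_neg:
  assumes p: "p \<in> nabla" "p \<noteq> (\<lambda>_. 0)"
  shows "H p < 0"
proof -
  obtain k where "p k \<noteq> 0" using p by auto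
  then show ?thesis
    unfolding H_def using suminf_pos2[OF summable_nabla_squares[OF p(1)], of k] by simp
qed

lemma zero_in_nabla: "(\<lambda>_. 0) \<in> nabla"
  by (simp add: nabla_def)

lemma H_zero [simp]: "H (\<lambda>_. 0) = 0"
  by (simp add: H_def)

section \<open>The law of the stick fractions\<close>

lemma nn_integral_power_kernel:
  fixes \<theta> a c :: real
  assumes "0 < \<theta>"
  shows "(\<integral>\<^sup>+x. ennreal (\<theta> * (c - x) powr (\<theta> - 1)) * indicator {a<..<c} x \<partial>lborel)
    = ennreal (max 0 (c - a) powr \<theta>)"
proof (cases "a < c")
  case True
  have "((\<lambda>x. x powr (\<theta> - 1)) has_integral ((c - a) powr (\<theta> - 1 + 1) / (\<theta> - 1 + 1))) {0..c - a}"
    using assms True by (intro has_integral_powr_from_0) auto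
  from has_integral_mult_right[OF this, of \<theta>]
  have int: "((\<lambda>x. \<theta> * x powr (\<theta> - 1)) has_integral ((c - a) powr \<theta>)) {0..c - a}"
    using assms by simp
  have "(\<integral>\<^sup>+x. ennreal (\<theta> * (c - x) powr (\<theta> - 1)) * indicator {a<..<c} x \<partial>lborel)
      = ennreal \<bar>-1\<bar> * (\<integral>\<^sup>+x. ennreal (\<theta> * (c - (c + (-1) * x)) powr (\<theta> - 1))
          * indicator {a<..<c} (c + (-1) * x) \<partial>lborel)"
    by (rule nn_integral_real_affine) auto
  also have "\<dots> = (\<integral>\<^sup>+x. ennreal (\<theta> * x powr (\<theta> - 1)) * indicator {0..c - a} x \<partial>lborel)"
    using AE_lborel_singleton[of 0] AE_lborel_singleton[of "c - a"]
    by (simp, intro nn_integral_cong_AE) (auto elim!: eventually_elim2 simp: indicator_def)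
  also have "\<dots> = ennreal ((c - a) powr \<theta>)"
    using assms by (intro nn_integral_has_integral_lebesgue'[OF _ int]) auto
  finally show ?thesis using True by simp
qed simp

lemma sets_beta1: "sets (beta1 \<theta>) = sets (restrict_space borel {0<..<1})"
  unfolding beta1_def sets_density by (intro sets_restrict_space_cong sets_lborel)

lemma space_beta1: "space (beta1 \<theta>) = {0<..<1}"
  using sets_eq_imp_space_eq[OF sets_beta1] by (simp add: space_restrict_space)

lemma measurable_ident_beta1 [measurable]: "(\<lambda>x. x) \<in> borel_measurable (beta1 \<theta>)"
  unfolding measurable_cong_sets[OF sets_beta1 refl] by (rule measurable_restrict_space1) simp

lemma nn_integral_beta1:
  assumes [measurable]: "f \<in> borel_measurable borel"
  shows "(\<integral>\<^sup>+x. f x \<partial>beta1 \<theta>)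
    = (\<integral>\<^sup>+x. ennreal (\<theta> * (1 - x) powr (\<theta> - 1)) * f x * indicator {0<..<1} x \<partial>lborel)"
proof -
  have "(\<integral>\<^sup>+x. f x \<partial>beta1 \<theta>)
      = (\<integral>\<^sup>+x. ennreal (\<theta> * (1 - x) powr (\<theta> - 1)) * f x \<partial>restrict_space lborel {0<..<1})"
    unfolding beta1_def
    by (intro nn_integral_density measurable_restrict_space1) auto
  also have "\<dots> = (\<integral>\<^sup>+x. ennreal (\<theta> * (1 - x) powr (\<theta> - 1)) * f x * indicator {0<..<1} x \<partial>lborel)"
    by (rule nn_integral_restrict_space) simp
  finally show ?thesis .
qed

lemma prob_space_beta1:
  assumes "0 < \<theta>"
  shows "prob_space (beta1 \<theta>)"
proof
  have "emeasure (beta1 \<theta>) (space (beta1 \<theta>)) = (\<integral>\<^sup>+x. 1 \<partial>beta1 \<theta>)" by simp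
  also have "\<dots> = ennreal (max 0 (1 - 0) powr \<theta>)"
    by (subst nn_integral_beta1, simp) (simp add: nn_integral_power_kernel[OF assms, of 1 0])
  finally show "emeasure (beta1 \<theta>) (space (beta1 \<theta>)) = 1" by simp
qed

text \<open>
  The identity behind both estimates. If a stick of length \<open>w\<close> loses the fraction
  \<open>x\<close>, the remaining length is \<open>v = w * (1 - x)\<close>, and the denominator in
  \<open>(1 - T / v) powr (\<theta> - 1)\<close> cancels against the factor \<open>(1 - x) powr
  (\<theta> - 1)\<close> of the density and leaves a pure power of \<open>1 - T / w - x\<close>.
\<close>

lemma nn_integral_beta1_rescaled_power:
  assumes "0 < \<theta>" "0 \<le> T" "0 < w" "0 \<le> a"
  shows "(\<integral>\<^sup>+x. indicator {a..} x * ennreal (max 0 (1 - T / (w * (1 - x))) powr (\<theta> - 1)) \<partial>beta1 \<theta>)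
    = ennreal (max 0 (1 - T / w - a) powr \<theta>)"
proof -
  let ?c = "1 - T / w"
  have "(\<integral>\<^sup>+x. indicator {a..} x * ennreal (max 0 (1 - T / (w * (1 - x))) powr (\<theta> - 1)) \<partial>beta1 \<theta>)
    = (\<integral>\<^sup>+x. ennreal (\<theta> * (1 - x) powr (\<theta> - 1))
        * (indicator {a..} x * ennreal (max 0 (1 - T / (w * (1 - x))) powr (\<theta> - 1)))
        * indicator {0<..<1} x \<partial>lborel)"
    by (rule nn_integral_beta1) measurable
  also have "\<dots> = (\<integral>\<^sup>+x. ennreal (\<theta> * (?c - x) powr (\<theta> - 1)) * indicator {a<..<?c} x \<partial>lborel)"
  proof (rule nn_integral_cong_AE, use AE_lborel_singleton[of a] in eventually_elim)
    case (elim x)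
    show ?case
    proof (cases "x \<in> {0<..<1}")
      case False
      have "x \<notin> {a<..<?c}"
        using False assms(4) divide_nonneg_pos[OF assms(2,3)]
        unfolding greaterThanLessThan_iff by linarith
      then show ?thesis using False by simp
    next
      case x: True
      have eq: "(1 - x) * (1 - T / (w * (1 - x))) = ?c - x"
        using x assms by (simp add: field_simps)
      show ?thesis
      proof (cases "x < ?c")
        case True
        then have "0 < 1 - T / (w * (1 - x))"
          using eq x by (metis diff_gt_0_iff_gt greaterThanLessThan_iff zero_less_mult_pos)
        then have "(1 - x) powr (\<theta> - 1) * max 0 (1 - T / (w * (1 - x))) powr (\<theta> - 1)
            = (?c - x) powr (\<theta> - 1)"
          using x by (simp add: powr_mult[symmetric] eq)
        then show ?thesis
          using x elim True assms by (auto simp: indicator_def ennreal_mult'[symmetric] mult.assoc)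
      next
        case False
        then have "1 - T / (w * (1 - x)) \<le> 0"
          using eq x by (smt (verit) greaterThanLessThan_iff mult_pos_pos)
        then show ?thesis using False by (simp add: indicator_def)
      qed
    qed
  qed
  also have "\<dots> = ennreal (max 0 (?c - a) powr \<theta>)" by (rule nn_integral_power_kernel[OF assms(1)])
  finally show ?thesis .
qed

abbreviation sticks :: "real \<Rightarrow> (nat \<Rightarrow> real) measure" where
  "sticks \<theta> \<equiv> PiM UNIV (\<lambda>_. beta1 \<theta>)"

lemma prob_space_sticks: "0 < \<theta> \<Longrightarrow> prob_space (sticks \<theta>)"
  by (intro prob_space_PiM prob_space_beta1)

lemma space_sticks: "space (sticks \<theta>) = {u. \<forall>k. u k \<in> {0<..<1}}"
  by (auto simp: space_PiM space_beta1 PiE_iff)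

lemma measurable_coordinate_sticks [measurable]: "(\<lambda>u. u k) \<in> borel_measurable (sticks \<theta>)"
proof -
  have "(\<lambda>u. u k) \<in> sticks \<theta> \<rightarrow>\<^sub>M beta1 \<theta>" by (rule measurable_component_singleton) simp
  from measurable_compose[OF this measurable_ident_beta1] show ?thesis .
qed

lemma measurable_stick_breaking [measurable]:
  "(\<lambda>u. stick_breaking u k) \<in> borel_measurable (sticks \<theta>)"
  unfolding stick_breaking_def by measurable

text \<open>
  The Markov property of stick breaking: after the first break the remaining fractions form a fresh
  copy of the same sequence.
\<close>

lemma emeasure_sticks_first_break:
  assumes \<theta>: "0 < \<theta>" and A: "A \<in> sets (sticks \<theta>)"
  shows "emeasure (sticks \<theta>) A
    = (\<integral>\<^sup>+x. emeasure (sticks \<theta>) {u \<in> space (sticks \<theta>). case_nat x u \<in> A} \<partial>beta1 \<theta>)"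
proof -
  interpret beta: prob_space "beta1 \<theta>" by (rule prob_space_beta1[OF \<theta>])
  interpret sticks: prob_space "sticks \<theta>" by (rule prob_space_sticks[OF \<theta>])
  interpret sequence_space "beta1 \<theta>" by unfold_locales
  let ?c = "\<lambda>(s, \<omega>). case_nat s \<omega> :: nat \<Rightarrow> real"
  have meas: "?c \<in> beta1 \<theta> \<Otimes>\<^sub>M sticks \<theta> \<rightarrow>\<^sub>M sticks \<theta>" by measurable
  have "emeasure (sticks \<theta>) A = emeasure (distr (beta1 \<theta> \<Otimes>\<^sub>M sticks \<theta>) (sticks \<theta>) ?c) A"
    by (simp add: PiM_iter)
  also have "\<dots> = emeasure (beta1 \<theta> \<Otimes>\<^sub>M sticks \<theta>) (?c -` A \<inter> space (beta1 \<theta> \<Otimes>\<^sub>M sticks \<theta>))"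
    by (rule emeasure_distr[OF meas A])
  also have "\<dots> = (\<integral>\<^sup>+x. emeasure (sticks \<theta>)
      (Pair x -` (?c -` A \<inter> space (beta1 \<theta> \<Otimes>\<^sub>M sticks \<theta>))) \<partial>beta1 \<theta>)"
    by (rule sticks.emeasure_pair_measure_alt) (rule measurable_sets[OF meas A])
  also have "\<dots> = (\<integral>\<^sup>+x. emeasure (sticks \<theta>) {u \<in> space (sticks \<theta>). case_nat x u \<in> A} \<partial>beta1 \<theta>)"
    by (intro nn_integral_cong arg_cong[where f="emeasure (sticks \<theta>)"])
      (auto simp: space_pair_measure)
  finally show ?thesis .
qed

lemma case_nat_in_space_sticks:
  "x \<in> space (beta1 \<theta>) \<Longrightarrow> u \<in> space (sticks \<theta>) \<Longrightarrow> case_nat x u \<in> space (sticks \<theta>)"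
  by (auto simp: space_sticks space_beta1 split: nat.split)

lemma emeasure_Collect_sticks_first_break:
  assumes \<theta>: "0 < \<theta>" and A: "{u \<in> space (sticks \<theta>). P u} \<in> sets (sticks \<theta>)"
  shows "emeasure (sticks \<theta>) {u \<in> space (sticks \<theta>). P u}
    = (\<integral>\<^sup>+x. emeasure (sticks \<theta>) {u \<in> space (sticks \<theta>). P (case_nat x u)} \<partial>beta1 \<theta>)"
  unfolding emeasure_sticks_first_break[OF \<theta> A]
  by (intro nn_integral_cong arg_cong[where f="emeasure (sticks \<theta>)"])
    (auto simp: case_nat_in_space_sticks)

lemma stick_breaking_case_nat_0: "stick_breaking (case_nat x u) 0 = x"
  by (simp add: stick_breaking_def)

lemma stick_breaking_case_nat_Suc:
  "stick_breaking (case_nat x u) (Suc k) = (1 - x) * stick_breaking u k"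
  by (simp add: stick_breaking_def prod.lessThan_Suc_shift del: prod.lessThan_Suc)

section \<open>An upper bound for the probability of several large pieces\<close>

text \<open>
  The injection \<open>f\<close> says which piece of a stick of length \<open>w\<close> serves which
  threshold. The bound \<open>N\<close> is there for induction, and the length \<open>w\<close> and
  the set \<open>R\<close> vary because breaking off a piece shortens the stick and may use up one
  threshold.
\<close>

definition hits :: "nat \<Rightarrow> nat set \<Rightarrow> (nat \<Rightarrow> real) \<Rightarrow> real \<Rightarrow> (nat \<Rightarrow> real) \<Rightarrow> bool" where
  "hits N R b w u \<longleftrightarrow>
     (\<exists>f. inj_on f R \<and> f ` R \<subseteq> {..<N} \<and> (\<forall>r\<in>R. b r \<le> w * stick_breaking u (f r)))"

lemma hits_case_nat:
  assumes "hits (Suc N) R b w (case_nat x u)"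
  shows "hits N R b (w * (1 - x)) u \<or>
    (\<exists>r\<in>R. b r \<le> w * x \<and> hits N (R - {r}) b (w * (1 - x)) u)"
proof -
  obtain f where f: "inj_on f R" "f ` R \<subseteq> {..<Suc N}"
    "\<And>r. r \<in> R \<Longrightarrow> b r \<le> w * stick_breaking (case_nat x u) (f r)"
    using assms unfolding hits_def by blast
  have shift: "hits N R' b (w * (1 - x)) u" if R': "R' \<subseteq> R" "\<And>r. r \<in> R' \<Longrightarrow> f r \<noteq> 0" for R'
    unfolding hits_def
  proof (intro exI[of _ "\<lambda>r. f r - 1"] conjI ballI)
    show "inj_on (\<lambda>r. f r - 1) R'"
    proof (rule inj_onI)
      fix r s assume rs: "r \<in> R'" "s \<in> R'" "f r - 1 = f s - 1"
      then have "f r = f s" using R'(2)[of r] R'(2)[of s] by simp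
      then show "r = s" using rs R'(1) f(1) by (meson inj_onD subsetD)
    qed
    show "(\<lambda>r. f r - 1) ` R' \<subseteq> {..<N}"
    proof
      fix k assume "k \<in> (\<lambda>r. f r - 1) ` R'"
      then obtain r where r: "r \<in> R'" "k = f r - 1" by blast
      then have "f r < Suc N" using R' f(2) by blast
      then show "k \<in> {..<N}" using R'(2)[OF r(1)] r by simp
    qed
    fix r assume r: "r \<in> R'"
    then obtain j where j: "f r = Suc j" using R'(2) not0_implies_Suc by blast
    show "b r \<le> w * (1 - x) * stick_breaking u (f r - 1)"
      using f(3)[of r] r R'(1) by (auto simp: j stick_breaking_case_nat_Suc mult.assoc)
  qed
  show ?thesis
  proof (cases "0 \<in> f ` R")
    case False
    then show ?thesis using shift[of R] by (metis image_eqI order_refl)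
  next
    case True
    then obtain r where r: "r \<in> R" "f r = 0" by auto
    have "f s \<noteq> 0" if "s \<in> R - {r}" for s
      using that r f(1) by (metis Diff_iff inj_onD insertCI)
    then have "hits N (R - {r}) b (w * (1 - x)) u" by (intro shift) auto
    moreover have "b r \<le> w * x"
      using f(3)[OF r(1)] by (simp add: r stick_breaking_case_nat_0)
    ultimately show ?thesis using r by blast
  qed
qed

text \<open>
  Measurability needs a finite choice of injections, so they are restricted to \<open>R\<close>.
\<close>

lemma hits_iff_PiE:
  "hits N R b w u \<longleftrightarrow>
     (\<exists>f\<in>R \<rightarrow>\<^sub>E {..<N}. inj_on f R \<and> (\<forall>r\<in>R. b r \<le> w * stick_breaking u (f r)))" (is "_ \<longleftrightarrow> ?rhs")
proof
  assume "hits N R b w u"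
  then obtain f where "inj_on f R" "f ` R \<subseteq> {..<N}"
    "\<forall>r\<in>R. b r \<le> w * stick_breaking u (f r)"
    unfolding hits_def by blast
  then show ?rhs
    by (intro bexI[of _ "restrict f R"]) (auto simp: inj_on_def)
next
  assume ?rhs
  then show "hits N R b w u" unfolding hits_def by blast
qed

lemma sets_hits:
  assumes "finite R"
  shows "{u \<in> space (sticks \<theta>). hits N R b w u} \<in> sets (sticks \<theta>)"
proof -
  have [simp]: "finite (R \<rightarrow>\<^sub>E {..<N})" using assms by (intro finite_PiE) auto
  note [simp] = assms
  show ?thesis unfolding hits_iff_PiE by measurable
qed

text \<open>
  The right-hand side is a supersolution of the first-step recursion. Write \<open>D m = m! /
  \<beta>\<^sup>m\<close>, let \<open>m\<close> be the cardinality of \<open>R\<close>,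
  \<open>T\<close> the sum of all thresholds and \<open>p\<close> the positive part of \<open>1 - T
  / w\<close>. The first piece either serves no threshold or serves one of the \<open>m\<close>
  thresholds, and by the cancellation identity each case integrates to \<open>p powr
  \<theta>\<close> times \<open>D m\<close> or \<open>D (m - 1)\<close>. Since \<open>m * D (m - 1)
  = \<beta> * D m\<close> and \<open>p \<le> 1 - \<beta>\<close> unless \<open>p\<close> vanishes,
  the total \<open>(1 + \<beta>) * D m * p powr \<theta>\<close> is at most \<open>D m * p powr
  (\<theta> - 1)\<close>. The constant in front does not depend on \<open>\<theta>\<close>, so only
  \<open>p\<close> matters on the exponential scale.
\<close>

lemma emeasure_hits_le:
  assumes \<theta>: "0 < \<theta>" and R: "finite R" and \<beta>: "0 < \<beta>" "\<And>r. r \<in> R \<Longrightarrow> \<beta> \<le> b r"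
    and w: "0 < w" "w \<le> 1"
  shows "emeasure (sticks \<theta>) {u \<in> space (sticks \<theta>). hits N R b w u}
    \<le> ennreal (fact (card R) / \<beta> ^ card R * max 0 (1 - sum b R / w) powr (\<theta> - 1))"
  using R \<beta>(2) w
proof (induction N arbitrary: R w)
  case (0 R w)
  interpret prob_space "sticks \<theta>" by (rule prob_space_sticks[OF \<theta>])
  show ?case
  proof (cases "R = {}")
    case True
    then show ?thesis by (simp add: emeasure_le_1)
  next
    case False
    then have "\<not> hits 0 R b w u" for u by (auto simp: hits_def)
    then show ?thesis by simp
  qed
next
  case (Suc N R w)
  interpret prob_space "sticks \<theta>" by (rule prob_space_sticks[OF \<theta>])
  show ?case
  proof (cases "R = {}")
    case True
    then show ?thesis by (simp add: emeasure_le_1)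
  next
    case False
    define D where "D n = fact n / \<beta> ^ n" for n :: nat
    have D_pos: "0 < D n" for n using \<beta> by (simp add: D_def)
    define m where "m = card R"
    have m: "0 < m" "\<And>r. r \<in> R \<Longrightarrow> card (R - {r}) = m - 1"
      using False Suc.prems(1) by (auto simp: m_def card_gt_0_iff)
    have mD: "real m * D (m - 1) = \<beta> * D m"
      using m(1) \<beta>(1) by (cases m) (simp_all add: D_def field_simps)
    have b0: "0 \<le> b r" if "r \<in> R" for r using Suc.prems(2)[OF that] \<beta>(1) by simp
    have sum0: "0 \<le> sum b R'" if "R' \<subseteq> R" for R' using that b0 by (intro sum_nonneg) auto
    have sum_ge: "\<beta> \<le> sum b R / w"
    proof -
      obtain r where r: "r \<in> R" using False by blast
      have "\<beta> \<le> b r" using Suc.prems(2) r .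
      also have "\<dots> \<le> sum b R" using r Suc.prems(1) b0 by (intro member_le_sum) auto
      also have "\<dots> \<le> sum b R / w"
        using Suc.prems(3,4) sum0[of R] by (simp add: pos_le_divide_eq mult_left_le)
      finally show ?thesis .
    qed
    define h where "h R' v = ennreal (D (card R') * max 0 (1 - sum b R' / v) powr (\<theta> - 1))" for R' v
    have step: "emeasure (sticks \<theta>) {u \<in> space (sticks \<theta>). hits (Suc N) R b w (case_nat x u)}
        \<le> h R (w * (1 - x)) + (\<Sum>r\<in>R. indicator {b r / w..} x * h (R - {r}) (w * (1 - x)))"
      if x: "x \<in> space (beta1 \<theta>)" for x
    proof -
      let ?E = "\<lambda>R'. {u \<in> space (sticks \<theta>). hits N R' b (w * (1 - x)) u}"
      let ?B = "{r\<in>R. b r \<le> w * x}"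
      have wx: "0 < w * (1 - x)" "w * (1 - x) \<le> 1"
        using x Suc.prems(3,4) by (auto simp: space_beta1 intro: mult_le_one)
      have IH: "emeasure (sticks \<theta>) (?E R') \<le> h R' (w * (1 - x))" if "R' \<subseteq> R" for R'
        unfolding h_def D_def
        using that Suc.prems(1,2) wx finite_subset by (intro Suc.IH) blast+
      have [simp]: "finite R" by (rule Suc.prems(1))
      have meas: "?E R' \<in> sets (sticks \<theta>)" if "R' \<subseteq> R" for R'
        using that Suc.prems(1) finite_subset by (intro sets_hits) blast
      have "{u \<in> space (sticks \<theta>). hits (Suc N) R b w (case_nat x u)}
          \<subseteq> ?E R \<union> (\<Union>r\<in>?B. ?E (R - {r}))"
        using hits_case_nat[of N R b w x] by blast
      then have "emeasure (sticks \<theta>) {u \<in> space (sticks \<theta>). hits (Suc N) R b w (case_nat x u)}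
          \<le> emeasure (sticks \<theta>) (?E R \<union> (\<Union>r\<in>?B. ?E (R - {r})))"
        by (rule emeasure_mono) (intro sets.Un sets.finite_UN meas, auto)
      also have "\<dots> \<le> emeasure (sticks \<theta>) (?E R) + emeasure (sticks \<theta>) (\<Union>r\<in>?B. ?E (R - {r}))"
        by (intro emeasure_subadditive sets.finite_UN meas) auto
      also have "\<dots> \<le> emeasure (sticks \<theta>) (?E R) + (\<Sum>r\<in>?B. emeasure (sticks \<theta>) (?E (R - {r})))"
        by (intro add_left_mono emeasure_subadditive_finite) (auto intro!: meas)
      also have "\<dots> \<le> h R (w * (1 - x)) + (\<Sum>r\<in>?B. h (R - {r}) (w * (1 - x)))"
        by (intro add_mono sum_mono IH) auto
      also have "(\<Sum>r\<in>?B. h (R - {r}) (w * (1 - x)))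
          = (\<Sum>r\<in>R. indicator {b r / w..} x * h (R - {r}) (w * (1 - x)))"
        using Suc.prems(3)
        by (intro sum.mono_neutral_cong_left) (auto simp: indicator_def field_simps)
      finally show ?thesis .
    qed
    have int: "(\<integral>\<^sup>+x. indicator {a..} x * h R' (w * (1 - x)) \<partial>beta1 \<theta>)
        = ennreal (D (card R') * max 0 (1 - sum b R' / w - a) powr \<theta>)"
      if "R' \<subseteq> R" "0 \<le> a" for R' a
    proof -
      have "(\<integral>\<^sup>+x. indicator {a..} x * h R' (w * (1 - x)) \<partial>beta1 \<theta>)
          = (\<integral>\<^sup>+x. ennreal (D (card R')) * (indicator {a..} x *
              ennreal (max 0 (1 - sum b R' / (w * (1 - x))) powr (\<theta> - 1))) \<partial>beta1 \<theta>)"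
        using D_pos[of "card R'"] by (simp add: h_def ennreal_mult' ac_simps)
      also have "\<dots> = ennreal (D (card R')) * (\<integral>\<^sup>+x. indicator {a..} x *
              ennreal (max 0 (1 - sum b R' / (w * (1 - x))) powr (\<theta> - 1)) \<partial>beta1 \<theta>)"
        by (rule nn_integral_cmult) measurable
      also have "\<dots> = ennreal (D (card R') * max 0 (1 - sum b R' / w - a) powr \<theta>)"
        using that sum0 Suc.prems(3) D_pos[of "card R'"]
        by (subst nn_integral_beta1_rescaled_power[OF \<theta>]) (auto simp: ennreal_mult')
      finally show ?thesis .
    qed
    define p where "p = max 0 (1 - sum b R / w)"
    have p_le: "(1 + \<beta>) * D m * p powr \<theta> \<le> D m * p powr (\<theta> - 1)"
    proof (cases "p = 0")
      case False
      then have "0 < p" by (auto simp: p_def)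
      moreover from this have "p = 1 - sum b R / w" by (simp add: p_def)
      ultimately have p: "0 < p" "p \<le> 1 - \<beta>" using sum_ge by auto
      have "(1 + \<beta>) * p \<le> (1 + \<beta>) * (1 - \<beta>)" using p \<beta>(1) by (intro mult_left_mono) auto
      also have "\<dots> \<le> 1" by (simp add: algebra_simps)
      finally have "((1 + \<beta>) * p) * (D m * p powr (\<theta> - 1)) \<le> 1 * (D m * p powr (\<theta> - 1))"
        using D_pos[of m] by (intro mult_right_mono) auto
      moreover have "p powr \<theta> = p * p powr (\<theta> - 1)"
        using p by (simp add: powr_diff)
      ultimately show ?thesis by (simp add: ac_simps)
    qed simp
    have h_meas: "(\<lambda>x. h R' (w * (1 - x))) \<in> borel_measurable (beta1 \<theta>)" for R'
      unfolding h_def by measurable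
    have "emeasure (sticks \<theta>) {u \<in> space (sticks \<theta>). hits (Suc N) R b w u}
        = (\<integral>\<^sup>+x. emeasure (sticks \<theta>) {u \<in> space (sticks \<theta>). hits (Suc N) R b w (case_nat x u)} \<partial>beta1 \<theta>)"
      by (rule emeasure_Collect_sticks_first_break[OF \<theta> sets_hits[OF Suc.prems(1)]])
    also have "\<dots> \<le> (\<integral>\<^sup>+x. indicator {0..} x * h R (w * (1 - x))
        + (\<Sum>r\<in>R. indicator {b r / w..} x * h (R - {r}) (w * (1 - x))) \<partial>beta1 \<theta>)"
      using step by (intro nn_integral_mono) (auto simp: space_beta1)
    also have "\<dots> = (\<integral>\<^sup>+x. indicator {0..} x * h R (w * (1 - x)) \<partial>beta1 \<theta>)
        + (\<Sum>r\<in>R. \<integral>\<^sup>+x. indicator {b r / w..} x * h (R - {r}) (w * (1 - x)) \<partial>beta1 \<theta>)"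
      using h_meas by (subst nn_integral_add) (auto simp: nn_integral_sum)
    also have "\<dots> = ennreal (D m * p powr \<theta>) + (\<Sum>r\<in>R. ennreal (D (m - 1) * p powr \<theta>))"
    proof (intro arg_cong2[where f="(+)"] sum.cong refl)
      show "(\<integral>\<^sup>+x. indicator {0..} x * h R (w * (1 - x)) \<partial>beta1 \<theta>) = ennreal (D m * p powr \<theta>)"
        using int[of R 0] by (simp add: m_def p_def)
      fix r assume r: "r \<in> R"
      have "sum b R = b r + sum b (R - {r})" using r Suc.prems(1) by (rule sum.remove[rotated])
      then have eq: "1 - sum b (R - {r}) / w - b r / w = 1 - sum b R / w"
        by (simp add: add_divide_distrib)
      then show "(\<integral>\<^sup>+x. indicator {b r / w..} x * h (R - {r}) (w * (1 - x)) \<partial>beta1 \<theta>)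
          = ennreal (D (m - 1) * p powr \<theta>)"
        using int[of "R - {r}" "b r / w"] b0[OF r] Suc.prems(3)
        unfolding eq m(2)[OF r] p_def[symmetric] by simp
    qed
    also have "\<dots> = ennreal (D m * p powr \<theta> + real m * (D (m - 1) * p powr \<theta>))"
      using D_pos[of m] D_pos[of "m - 1"]
      by (simp add: m_def[symmetric] ennreal_plus[symmetric] ennreal_of_nat_eq_real_of_nat
          ennreal_mult'[symmetric] del: ennreal_plus)
    also have "D m * p powr \<theta> + real m * (D (m - 1) * p powr \<theta>) = (1 + \<beta>) * D m * p powr \<theta>"
      using mD by (simp add: algebra_simps)
    also have "ennreal \<dots> \<le> ennreal (D m * p powr (\<theta> - 1))" by (rule ennreal_leI[OF p_le])
    finally show ?thesis by (simp only: D_def m_def p_def)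
  qed
qed

lemma emeasure_ever_hits_le:
  assumes \<theta>: "0 < \<theta>" and R: "finite R" and \<beta>: "0 < \<beta>" "\<And>r. r \<in> R \<Longrightarrow> \<beta> \<le> b r"
  shows "emeasure (sticks \<theta>) {u \<in> space (sticks \<theta>). \<exists>N. hits N R b 1 u}
    \<le> ennreal (fact (card R) / \<beta> ^ card R * max 0 (1 - sum b R) powr (\<theta> - 1))"
proof -
  let ?E = "\<lambda>N. {u \<in> space (sticks \<theta>). hits N R b 1 u}"
  have "incseq ?E" by (force simp: incseq_def hits_def)
  then have "emeasure (sticks \<theta>) (\<Union>N. ?E N) = (SUP N. emeasure (sticks \<theta>) (?E N))"
    by (intro SUP_emeasure_incseq[symmetric]) (auto intro!: sets_hits R)
  also have "\<dots> \<le> ennreal (fact (card R) / \<beta> ^ card R * max 0 (1 - sum b R) powr (\<theta> - 1))"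
    using emeasure_hits_le[OF \<theta> R \<beta>, where w = 1] by (intro SUP_least) simp
  also have "(\<Union>N. ?E N) = {u \<in> space (sticks \<theta>). \<exists>N. hits N R b 1 u}" by blast
  finally show ?thesis .
qed

section \<open>A lower bound for the probability of prescribed pieces\<close>

text \<open>
  The largest pieces are asked to come first and in the order of \<open>p\<close>: this one ordering
  already carries the full exponential rate. As in \<^const>\<open>hits\<close>, \<open>w\<close> is
  the length of the stick.
\<close>

definition tracks :: "nat \<Rightarrow> (nat \<Rightarrow> real) \<Rightarrow> real \<Rightarrow> real \<Rightarrow> (nat \<Rightarrow> real) \<Rightarrow> bool" where
  "tracks n p d w u \<longleftrightarrow>
     (\<forall>k<n. p k \<le> w * stick_breaking u k \<and> w * stick_breaking u k \<le> p k + d) \<and>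
     (\<forall>k\<ge>n. w * stick_breaking u k \<le> d)"

lemma tracks_case_nat:
  "tracks (Suc n) p d w (case_nat x u) \<longleftrightarrow>
     p 0 \<le> w * x \<and> w * x \<le> p 0 + d \<and> tracks n (\<lambda>k. p (Suc k)) d (w * (1 - x)) u"
proof -
  have shift: "(\<forall>k\<ge>Suc n. P k) \<longleftrightarrow> (\<forall>k\<ge>n. P (Suc k))" for P by (metis Suc_le_D Suc_le_mono)
  show ?thesis
    unfolding tracks_def shift All_less_Suc2
    by (simp add: stick_breaking_case_nat_0 stick_breaking_case_nat_Suc mult.assoc conj_ac)
qed

lemma sets_tracks: "{u \<in> space (sticks \<theta>). tracks n p d w u} \<in> sets (sticks \<theta>)"
  unfolding tracks_def by measurable

text \<open>
  Induction on \<open>n\<close> over the first break. Restricting the first fraction to an interval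
  of length \<open>d / w\<close> leaves a stick long enough for the remaining targets. The power in
  the induction hypothesis cancels against the density, the integrand is smallest at the right end
  of the interval, and each break contributes a factor \<open>\<theta> * d\<close>. The constant
  \<open>\<kappa>\<close> accounts for the tail of small pieces.
\<close>

lemma emeasure_tracks_ge:
  assumes \<theta>: "1 < \<theta>" and d: "0 < d" and \<kappa>: "0 \<le> \<kappa>"
    and base: "ennreal \<kappa> \<le> emeasure (sticks \<theta>) {u \<in> space (sticks \<theta>). \<forall>k. stick_breaking u k \<le> d}"
    and p: "\<And>k. 0 \<le> p k" and w: "w \<le> 1" "(\<Sum>k<n. p k) + real n * d < w"
  shows "ennreal (\<kappa> * (\<theta> * d) ^ n * ((w - ((\<Sum>k<n. p k) + real n * d)) / w) powr (\<theta> - 1))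
    \<le> emeasure (sticks \<theta>) {u \<in> space (sticks \<theta>). tracks n p d w u}"
  using p w
proof (induction n arbitrary: p w)
  case (0 p w)
  have "{u \<in> space (sticks \<theta>). \<forall>k. stick_breaking u k \<le> d} \<subseteq> {u \<in> space (sticks \<theta>). tracks 0 p d w u}"
  proof safe
    fix u assume u: "u \<in> space (sticks \<theta>)" "\<forall>k. stick_breaking u k \<le> d"
    have "w * stick_breaking u k \<le> 1 * stick_breaking u k" for k
      using 0 u stick_breaking_pos[of u k]
      by (intro mult_right_mono) (auto simp: space_sticks less_imp_le)
    then show "tracks 0 p d w u" using u by (auto simp: tracks_def intro: order_trans)
  qed
  then have "emeasure (sticks \<theta>) {u \<in> space (sticks \<theta>). \<forall>k. stick_breaking u k \<le> d}
      \<le> emeasure (sticks \<theta>) {u \<in> space (sticks \<theta>). tracks 0 p d w u}"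
    by (intro emeasure_mono sets_tracks)
  then show ?case using 0 base by simp
next
  case (Suc n p w)
  define A where "A = (\<Sum>k<n. p (Suc k)) + real n * d"
  have A: "(\<Sum>k<Suc n. p k) + real (Suc n) * d = p 0 + d + A"
    by (simp add: A_def sum.lessThan_Suc_shift algebra_simps del: sum.lessThan_Suc)
  have A0: "0 \<le> A" using Suc.prems(1) d by (auto simp: A_def intro!: add_nonneg_nonneg sum_nonneg)
  have w: "0 < w" "w \<le> 1" "p 0 + d + A < w"
    using Suc.prems(1)[of 0] Suc.prems(2,3) A A0 d by auto
  define C where "C = \<kappa> * (\<theta> * d) ^ n"
  have C: "0 \<le> C" using \<kappa> \<theta> d by (simp add: C_def)
  define q where "q = ((w - (p 0 + d + A)) / w) powr (\<theta> - 1)"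
  let ?J = "{p 0 / w<..<(p 0 + d) / w}"
  have "0 \<le> p 0 / w" "(p 0 + d) / w \<le> 1" using w Suc.prems(1)[of 0] A0 by auto
  then have J: "?J \<subseteq> {0<..<1}" by auto
  have step: "indicator ?J x * ennreal (C * ((w * (1 - x) - A) / (w * (1 - x))) powr (\<theta> - 1))
      \<le> emeasure (sticks \<theta>) {u \<in> space (sticks \<theta>). tracks (Suc n) p d w (case_nat x u)}" for x
  proof (cases "x \<in> ?J")
    case True
    then have x: "p 0 < w * x" "w * x < p 0 + d" using w by (auto simp: field_simps)
    have "0 < x" "x < 1" using True J by auto
    have "ennreal (C * ((w * (1 - x) - A) / (w * (1 - x))) powr (\<theta> - 1))
        \<le> emeasure (sticks \<theta>) {u \<in> space (sticks \<theta>). tracks n (\<lambda>k. p (Suc k)) d (w * (1 - x)) u}"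
      unfolding C_def A_def
    proof (rule Suc.IH)
      show "w * (1 - x) \<le> 1" using w \<open>0 < x\<close> \<open>x < 1\<close> by (intro mult_le_one) auto
      show "(\<Sum>k<n. p (Suc k)) + real n * d < w * (1 - x)"
        using w x unfolding A_def by (simp add: algebra_simps)
    qed (rule Suc.prems(1))
    then show ?thesis using x True by (simp add: tracks_case_nat)
  qed simp
  have "ennreal (\<kappa> * (\<theta> * d) ^ Suc n * q) = ennreal (\<theta> * C * q * d)"
    by (simp add: C_def ac_simps)
  also have "\<dots> \<le> ennreal (\<theta> * C * q * (d / w))"
    using w C \<theta> d by (intro ennreal_leI mult_left_mono) (auto simp: pos_le_divide_eq mult_left_le q_def)
  also have "\<dots> = (\<integral>\<^sup>+x. ennreal (\<theta> * C * q) * indicator ?J x \<partial>lborel)"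
    using w d C \<theta>
    by (subst nn_integral_cmult_indicator)
      (auto simp: ennreal_mult'[symmetric] q_def divide_right_mono diff_divide_distrib[symmetric])
  also have "\<dots> \<le> (\<integral>\<^sup>+x. ennreal (\<theta> * (1 - x) powr (\<theta> - 1)) * (indicator ?J x *
      ennreal (C * ((w * (1 - x) - A) / (w * (1 - x))) powr (\<theta> - 1))) * indicator {0<..<1} x \<partial>lborel)"
  proof (rule nn_integral_mono)
    fix x :: real
    show "ennreal (\<theta> * C * q) * indicator ?J x \<le> ennreal (\<theta> * (1 - x) powr (\<theta> - 1)) * (indicator ?J x *
      ennreal (C * ((w * (1 - x) - A) / (w * (1 - x))) powr (\<theta> - 1))) * indicator {0<..<1} x"
    proof (cases "x \<in> ?J")
      case True
      then have x: "p 0 < w * x" "w * x < p 0 + d" using w by (auto simp: field_simps)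
      have x01: "0 < x" "x < 1" using True J by auto
      have num: "w - (p 0 + d + A) \<le> w * (1 - x) - A" using x by (simp add: algebra_simps)
      have eq: "(1 - x) powr (\<theta> - 1) * ((w * (1 - x) - A) / (w * (1 - x))) powr (\<theta> - 1)
          = ((w * (1 - x) - A) / w) powr (\<theta> - 1)"
      proof -
        have "(1 - x) * ((w * (1 - x) - A) / (w * (1 - x))) = (w * (1 - x) - A) / w"
          using x01 w by (simp add: divide_simps)
        then show ?thesis using x01 w num by (subst powr_mult[symmetric]) auto
      qed
      have "q \<le> ((w * (1 - x) - A) / w) powr (\<theta> - 1)"
        unfolding q_def using num w \<theta> by (intro powr_mono2 divide_right_mono) auto
      then have "\<theta> * C * q \<le> \<theta> * C * ((w * (1 - x) - A) / w) powr (\<theta> - 1)"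
        using \<theta> C by (intro mult_left_mono) auto
      also have "\<dots> = (\<theta> * (1 - x) powr (\<theta> - 1))
          * (C * ((w * (1 - x) - A) / (w * (1 - x))) powr (\<theta> - 1))"
        unfolding eq[symmetric] by simp
      finally have "ennreal (\<theta> * C * q) \<le> ennreal ((\<theta> * (1 - x) powr (\<theta> - 1))
          * (C * ((w * (1 - x) - A) / (w * (1 - x))) powr (\<theta> - 1)))"
        by (rule ennreal_leI)
      also have "\<dots> = ennreal (\<theta> * (1 - x) powr (\<theta> - 1))
          * ennreal (C * ((w * (1 - x) - A) / (w * (1 - x))) powr (\<theta> - 1))"
        using \<theta> by (intro ennreal_mult') auto
      finally show ?thesis using True x01 by simp
    qed simp
  qed
  also have "\<dots> = (\<integral>\<^sup>+x. indicator ?J x *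
      ennreal (C * ((w * (1 - x) - A) / (w * (1 - x))) powr (\<theta> - 1)) \<partial>beta1 \<theta>)"
    by (rule nn_integral_beta1[symmetric]) measurable
  also have "\<dots> \<le> (\<integral>\<^sup>+x. emeasure (sticks \<theta>)
      {u \<in> space (sticks \<theta>). tracks (Suc n) p d w (case_nat x u)} \<partial>beta1 \<theta>)"
    by (rule nn_integral_mono) (rule step)
  also have "\<dots> = emeasure (sticks \<theta>) {u \<in> space (sticks \<theta>). tracks (Suc n) p d w u}"
    using \<theta> by (intro emeasure_Collect_sticks_first_break[symmetric] sets_tracks) auto
  finally show ?case unfolding A q_def .
qed

section \<open>The local rate of the Poisson--Dirichlet law\<close>

lemma obtain_ranking:
  assumes "u \<in> space (sticks \<theta>)"
  obtains \<sigma> where "bij \<sigma>" "kth_largest (stick_breaking u) = stick_breaking u \<circ> \<sigma>"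
proof -
  have u: "u k \<in> {0<..<1}" for k using assms by (simp add: space_sticks)
  obtain \<sigma> where \<sigma>: "bij \<sigma>" "decseq (stick_breaking u \<circ> \<sigma>)"
    by (rule ex_descending_rearrangement[OF stick_breaking_pos[OF u]
        summable_LIMSEQ_zero[OF stick_breaking_summable(1)[OF u]]])
  show ?thesis
    by (rule that[OF \<sigma>(1) kth_largest_eq_descending_rearrangement[OF \<sigma>]])
qed

lemma kth_largest_stick_breaking_in_nabla:
  assumes "u \<in> space (sticks \<theta>)"
  shows "kth_largest (stick_breaking u) \<in> nabla"
proof -
  have u: "u k \<in> {0<..<1}" for k using assms by (simp add: space_sticks)
  show ?thesis
    by (rule kth_largest_in_nabla[OF stick_breaking_pos[OF u] stick_breaking_summable[OF u]])
qed

lemma measurable_kth_largest_stick_breaking: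
  "(\<lambda>u. kth_largest (stick_breaking u)) \<in> sticks \<theta> \<rightarrow>\<^sub>M restrict_space borel nabla"
proof (rule measurable_restrict_space2)
  show "(\<lambda>u. kth_largest (stick_breaking u)) \<in> space (sticks \<theta>) \<rightarrow> nabla"
    using kth_largest_stick_breaking_in_nabla by (rule Pi_I)
  show "(\<lambda>u. kth_largest (stick_breaking u)) \<in> borel_measurable (sticks \<theta>)"
  proof (rule measurable_coordinatewise_then_product)
    fix k
    show "(\<lambda>u. kth_largest (stick_breaking u) k) \<in> borel_measurable (sticks \<theta>)"
      unfolding kth_largest_def
    proof (rule borel_measurable_cSUP)
      show "countable {A :: nat set. finite A \<and> card A = Suc k}"
        by (rule countable_subset[OF Collect_mono countable_Collect_finite]) simp
      show "(\<lambda>u. Min (stick_breaking u ` A)) \<in> borel_measurable (sticks \<theta>)"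
        if "A \<in> {A. finite A \<and> card A = Suc k}" for A
        using that by (intro borel_measurable_Min) auto
      show "bdd_above ((\<lambda>A. Min (stick_breaking u ` A)) ` {A. finite A \<and> card A = Suc k})"
        if "u \<in> space (sticks \<theta>)" for u
      proof (rule bdd_above_kth_largest)
        show "stick_breaking u j \<le> 1" for j
          by (rule stick_breaking_le_1) (use that in \<open>simp add: space_sticks\<close>)
      qed
    qed
  qed
qed

lemma sets_PD: "sets (PD \<theta>) = sets (restrict_space borel nabla)"
  by (simp add: PD_def)

lemma space_PD: "space (PD \<theta>) = nabla"
  by (simp add: PD_def space_restrict_space)

lemma prob_space_PD: "0 < \<theta> \<Longrightarrow> prob_space (PD \<theta>)"
  unfolding PD_def
  by (intro prob_space.prob_space_distr prob_space_sticks measurable_kth_largest_stick_breaking)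

lemma open_Int_nabla_in_sets_PD: "open U \<Longrightarrow> U \<inter> nabla \<in> sets (PD \<theta>)"
  by (auto simp: sets_PD sets_restrict_space)

lemma measure_PD_open:
  assumes "open U"
  shows "measure (PD \<theta>) (U \<inter> nabla)
    = measure (sticks \<theta>) {u \<in> space (sticks \<theta>). kth_largest (stick_breaking u) \<in> U}"
proof -
  have "measure (PD \<theta>) (U \<inter> nabla) = measure (sticks \<theta>)
      ((\<lambda>u. kth_largest (stick_breaking u)) -` (U \<inter> nabla) \<inter> space (sticks \<theta>))"
    unfolding PD_def
    using open_Int_nabla_in_sets_PD[OF assms, of \<theta>]
    by (intro measure_distr measurable_kth_largest_stick_breaking) (simp add: sets_PD)
  also have "(\<lambda>u. kth_largest (stick_breaking u)) -` (U \<inter> nabla) \<inter> space (sticks \<theta>)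
      = {u \<in> space (sticks \<theta>). kth_largest (stick_breaking u) \<in> U}"
    using kth_largest_stick_breaking_in_nabla by blast
  finally show ?thesis .
qed

lemma sets_kth_largest_open:
  assumes "open U"
  shows "{u \<in> space (sticks \<theta>). kth_largest (stick_breaking u) \<in> U} \<in> sets (sticks \<theta>)"
proof -
  have "(\<lambda>u. kth_largest (stick_breaking u)) -` (U \<inter> nabla) \<inter> space (sticks \<theta>) \<in> sets (sticks \<theta>)"
    using open_Int_nabla_in_sets_PD[OF assms, of \<theta>]
    by (intro measurable_sets[OF measurable_kth_largest_stick_breaking]) (simp add: sets_PD)
  also have "(\<lambda>u. kth_largest (stick_breaking u)) -` (U \<inter> nabla) \<inter> space (sticks \<theta>)
      = {u \<in> space (sticks \<theta>). kth_largest (stick_breaking u) \<in> U}"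
    using kth_largest_stick_breaking_in_nabla by blast
  finally show ?thesis .
qed

text \<open>
  On the exponential scale \<open>S p\<close> is the rate of \<open>(1 - suminf p) powr
  \<theta>\<close>; this form also covers a vanishing base, where \<open>S p\<close> is infinite.
\<close>

lemma less_S_iff:
  assumes "p \<in> nabla"
  shows "ereal M < S p \<longleftrightarrow> 1 - suminf p < exp (- M)"
proof (cases "suminf p < 1")
  case True
  have "M < ln (1 / (1 - suminf p)) \<longleftrightarrow> ln (1 - suminf p) < - M"
    using True by (simp add: ln_div) linarith
  also have "\<dots> \<longleftrightarrow> 1 - suminf p < exp (- M)"
    using True by (subst exp_less_cancel_iff[symmetric]) simp
  finally show ?thesis using True by (simp add: S_def)
next
  case False
  then have "1 - suminf p < exp (- M)" by (intro le_less_trans[OF _ exp_gt_zero]) simp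
  then show ?thesis using False by (simp add: S_def)
qed

lemma S_less_iff:
  assumes "p \<in> nabla"
  shows "S p < ereal M \<longleftrightarrow> exp (- M) < 1 - suminf p"
proof (cases "suminf p < 1")
  case True
  have "ln (1 / (1 - suminf p)) < M \<longleftrightarrow> - M < ln (1 - suminf p)"
    using True by (simp add: ln_div) linarith
  also have "\<dots> \<longleftrightarrow> exp (- M) < 1 - suminf p"
    using True by (subst exp_less_cancel_iff[symmetric]) simp
  finally show ?thesis using True by (simp add: S_def)
next
  case False
  then have "\<not> exp (- M) < 1 - suminf p" using exp_gt_zero[of "- M"] by linarith
  then show ?thesis using False by (simp add: S_def)
qed

lemma eventually_mult_powr_le_exp:
  fixes C r M :: real
  assumes C: "0 \<le> C" and r: "0 \<le> r" "r < exp (- M)"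
  shows "\<forall>\<^sub>F \<theta> in at_top. C * r powr (\<theta> - 1) \<le> exp (- (\<theta> * M))"
proof -
  obtain s where s: "r < s" "s < exp (- M)" using r dense by blast
  then have "0 < s" using r by simp
  have "ln s < - M" using s \<open>0 < s\<close> by (subst exp_less_cancel_iff[symmetric]) simp
  then have "M < - ln s" by simp
  then have "\<forall>\<^sub>F \<theta> in at_top. C / s * exp (- (\<theta> * (- ln s))) \<le> exp (- (\<theta> * M))"
    by (rule eventually_mult_exp_le_exp)
  then show ?thesis
    using eventually_gt_at_top[of 1]
  proof eventually_elim
    case (elim \<theta>)
    have "C * r powr (\<theta> - 1) \<le> C * s powr (\<theta> - 1)"
      using C r s elim by (intro mult_left_mono powr_mono2) auto
    also have "s powr (\<theta> - 1) = exp (- (\<theta> * (- ln s))) / s"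
      using \<open>0 < s\<close> by (simp add: powr_diff) (simp add: powr_def)
    finally show ?case using elim by simp
  qed
qed

text \<open>
  Only finitely many coordinates can be controlled in the product topology, so \<open>U\<close> asks
  that the first few positive coordinates stay above a fraction \<open>l < 1\<close> of those of
  \<open>p\<close>. If they carry enough mass, the recursion for distinct large pieces bounds the
  probability of finding pieces this large.
\<close>

lemma PD_local_upper:
  assumes p: "p \<in> nabla" and M: "ereal M < S p"
  shows "\<exists>U. open U \<and> p \<in> U \<and>
    (\<forall>\<^sub>F \<theta> in at_top. measure (PD \<theta>) (U \<inter> nabla) \<le> exp (- (\<theta> * M)))"
proof -
  have "(\<lambda>n. \<Sum>k<n. p k) \<longlonglongrightarrow> suminf p"
    using p by (intro summable_LIMSEQ) (simp add: nabla_def)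
  moreover have "1 - exp (- M) < suminf p" using M less_S_iff[OF p] by simp
  ultimately have "\<forall>\<^sub>F n in sequentially. 1 - exp (- M) < (\<Sum>k<n. p k)"
    by (rule order_tendstoD(1))
  then obtain n where n: "1 - exp (- M) < (\<Sum>k<n. p k)" using eventually_happens'[OF sequentially_bot] by blast
  have "((\<lambda>l. l * (\<Sum>k<n. p k)) \<longlongrightarrow> 1 * (\<Sum>k<n. p k)) (at_left 1)"
    by (intro tendsto_intros)
  then have "\<forall>\<^sub>F l in at_left 1. 1 - exp (- M) < l * (\<Sum>k<n. p k)"
    using n by (intro order_tendstoD(1)) auto
  moreover have "\<forall>\<^sub>F l::real in at_left 1. l \<in> {0<..<1}"
    by (rule eventually_at_left_real) simp
  ultimately have "\<forall>\<^sub>F l in at_left 1. 1 - exp (- M) < l * (\<Sum>k<n. p k) \<and> l \<in> {0<..<1}"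
    by (rule eventually_conj)
  then obtain l where l: "1 - exp (- M) < l * (\<Sum>k<n. p k)" "0 < l" "l < 1"
    using eventually_happens'[of "at_left (1::real)"] by (auto simp: trivial_limit_at_left_real)
  define R where "R = {k. k < n \<and> 0 < p k}"
  define b where "b k = l * p k" for k
  define \<beta> where "\<beta> = Min (insert 1 (b ` R))"
  have R: "finite R" by (simp add: R_def)
  have \<beta>: "0 < \<beta>" "\<beta> \<le> b r" if "r \<in> R" for r
    using R l that by (auto simp: \<beta>_def b_def R_def)
  have \<beta>0: "0 < \<beta>" using R l by (auto simp: \<beta>_def b_def R_def)
  have sum_b: "sum b R = l * (\<Sum>k<n. p k)"
  proof -
    have "sum p R = (\<Sum>k<n. p k)"
      using p by (intro sum.mono_neutral_left) (auto simp: R_def nabla_def not_less intro: antisym)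
    then show ?thesis by (simp add: b_def[abs_def] sum_distrib_left[symmetric])
  qed
  define U where "U = (\<Inter>k\<in>R. {q :: nat \<Rightarrow> real. b k < q k})"
  have "open U"
    unfolding U_def
    by (intro open_INT R ballI open_Collect_less continuous_on_const continuous_on_product_coordinates)
  moreover have "p \<in> U" using l by (auto simp: U_def R_def b_def)
  moreover have "\<forall>\<^sub>F \<theta> in at_top. measure (PD \<theta>) (U \<inter> nabla) \<le> exp (- (\<theta> * M))"
  proof -
    define C where "C = fact (card R) / \<beta> ^ card R"
    have "C \<ge> 0" using \<beta>0 by (simp add: C_def)
    then have "\<forall>\<^sub>F \<theta> in at_top. C * max 0 (1 - sum b R) powr (\<theta> - 1) \<le> exp (- (\<theta> * M))"
      using l by (intro eventually_mult_powr_le_exp) (auto simp: sum_b)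
    then show ?thesis
      using eventually_gt_at_top[of 0]
    proof eventually_elim
      case (elim \<theta>)
      interpret prob_space "sticks \<theta>" by (rule prob_space_sticks) (use elim in simp)
      have meas: "{u \<in> space (sticks \<theta>). \<exists>N. hits N R b 1 u} \<in> sets (sticks \<theta>)"
        using sets_hits[OF R] by measurable
      have "{u \<in> space (sticks \<theta>). kth_largest (stick_breaking u) \<in> U}
          \<subseteq> {u \<in> space (sticks \<theta>). \<exists>N. hits N R b 1 u}"
      proof safe
        fix u assume u: "u \<in> space (sticks \<theta>)" "kth_largest (stick_breaking u) \<in> U"
        obtain \<sigma> where \<sigma>: "bij \<sigma>" "kth_largest (stick_breaking u) = stick_breaking u \<circ> \<sigma>"
          using obtain_ranking[OF u(1)] by blast
        obtain N where "\<sigma> ` R \<subseteq> {..<N}" using finite_nat_bounded[OF finite_imageI[OF R]] by blast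
        then have "hits N R b 1 u"
          unfolding hits_def
          using \<sigma>(2) u(2) inj_on_subset[OF bij_is_inj[OF \<sigma>(1)] subset_UNIV]
          by (intro exI[of _ \<sigma>]) (auto simp: U_def less_imp_le)
        then show "\<exists>N. hits N R b 1 u" ..
      qed
      then have "ennreal (measure (PD \<theta>) (U \<inter> nabla))
          \<le> emeasure (sticks \<theta>) {u \<in> space (sticks \<theta>). \<exists>N. hits N R b 1 u}"
        unfolding measure_PD_open[OF \<open>open U\<close>] emeasure_eq_measure
        by (intro ennreal_leI finite_measure_mono meas)
      also have "\<dots> \<le> ennreal (C * max 0 (1 - sum b R) powr (\<theta> - 1))"
        unfolding C_def using elim \<beta> \<beta>0 by (intro emeasure_ever_hits_le R) auto
      also have "\<dots> \<le> ennreal (exp (- (\<theta> * M)))" by (intro ennreal_leI elim)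
      finally show ?case by simp
    qed
  qed
  ultimately show ?thesis by blast
qed

text \<open>
  A single piece exceeding \<open>d\<close> is already exponentially unlikely.
\<close>

lemma eventually_all_sticks_small:
  assumes d: "0 < d"
  shows "\<forall>\<^sub>F \<theta> in at_top. ennreal (1 / 2)
    \<le> emeasure (sticks \<theta>) {u \<in> space (sticks \<theta>). \<forall>k. stick_breaking u k \<le> d}"
proof -
  have "\<forall>\<^sub>F \<theta> in at_top. 2 / d * max 0 (1 - d) powr (\<theta> - 1) \<le> exp (- (\<theta> * 0))"
    using d by (intro eventually_mult_powr_le_exp) auto
  then show ?thesis
    using eventually_gt_at_top[of 0]
  proof eventually_elim
    case (elim \<theta>)
    interpret prob_space "sticks \<theta>" by (rule prob_space_sticks) (use elim in simp)
    let ?small = "{u \<in> space (sticks \<theta>). \<forall>k. stick_breaking u k \<le> d}"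
    let ?hit = "{u \<in> space (sticks \<theta>). \<exists>N. hits N {0} (\<lambda>_. d) 1 u}"
    have meas: "?small \<in> sets (sticks \<theta>)" by measurable
    have meas': "?hit \<in> sets (sticks \<theta>)"
      using sets_hits[of "{0}"] by measurable
    have "space (sticks \<theta>) - ?small \<subseteq> ?hit"
    proof safe
      fix u k assume "u \<in> space (sticks \<theta>)" "\<not> stick_breaking u k \<le> d"
      then have "hits (Suc k) {0} (\<lambda>_. d) 1 u"
        unfolding hits_def by (intro exI[of _ "\<lambda>_. k"]) auto
      then show "\<exists>N. hits N {0} (\<lambda>_. d) 1 u" ..
    qed
    then have "1 - prob ?small \<le> prob ?hit"
      unfolding prob_compl[OF meas, symmetric] by (intro finite_measure_mono meas')
    moreover have "ennreal (prob ?hit) \<le> ennreal (1 / d * max 0 (1 - d) powr (\<theta> - 1))"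
      unfolding emeasure_eq_measure[symmetric]
      using emeasure_ever_hits_le[of \<theta> "{0}" d "\<lambda>_. d"] elim d by simp
    then have "prob ?hit \<le> 1 / d * max 0 (1 - d) powr (\<theta> - 1)"
      using d by (subst (asm) ennreal_le_iff) auto
    ultimately have "1 / 2 \<le> prob ?small" using elim by simp
    then show ?case unfolding emeasure_eq_measure by (rule ennreal_leI)
  qed
qed

lemma open_contains_coordinate_box:
  fixes U :: "(nat \<Rightarrow> real) set"
  assumes "open U" "p \<in> U"
  obtains n d where "0 < d" "\<And>q. (\<And>k. k < n \<Longrightarrow> \<bar>q k - p k\<bar> < d) \<Longrightarrow> q \<in> U"
proof -
  have "openin (product_topology (\<lambda>_::nat. euclidean) UNIV) U"
    using assms(1) by (simp add: euclidean_product_topology)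
  from product_topology_open_contains_basis[OF this assms(2)]
  obtain X :: "nat \<Rightarrow> real set" where X: "p \<in> PiE UNIV X" "\<And>i. open (X i)" "finite {i. X i \<noteq> UNIV}"
    "PiE UNIV X \<subseteq> U"
    by auto
  obtain n where n: "{i. X i \<noteq> UNIV} \<subseteq> {..<n}" using finite_nat_bounded[OF X(3)] by blast
  have "\<exists>e>0. ball (p i) e \<subseteq> X i" for i
    using X(1,2) by (metis UNIV_I PiE_mem open_contains_ball)
  then obtain e where e: "\<And>i. 0 < e i" "\<And>i. ball (p i) (e i) \<subseteq> X i" by metis
  define d where "d = Min (insert 1 (e ` {..<n}))"
  have "0 < d" using e by (simp add: d_def)
  moreover have "q \<in> U" if q: "\<And>k. k < n \<Longrightarrow> \<bar>q k - p k\<bar> < d" for q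
  proof -
    have "q i \<in> X i" for i
    proof (cases "i < n")
      case True
      then have "d \<le> e i" by (simp add: d_def)
      then have "q i \<in> ball (p i) (e i)" using q[OF True] by (simp add: dist_real_def)
      then show ?thesis using e(2) by blast
    qed (use n in auto)
    then show ?thesis using X(4) by auto
  qed
  ultimately show ?thesis by (rule that)
qed

lemma tracks_near:
  assumes u: "u \<in> space (sticks \<theta>)" and track: "tracks n p d 1 u"
    and p: "p \<in> nabla" and k: "k < n" and d: "0 < d"
  shows "\<bar>kth_largest (stick_breaking u) k - p k\<bar> \<le> d"
proof -
  define p' where "p' j = (if j < n then p j else 0)" for j
  have "decseq p'" using p by (auto simp: p'_def nabla_def decseq_def)
  moreover have "0 \<le> p' j" for j using p by (simp add: p'_def nabla_def)
  moreover have "\<bar>stick_breaking u j - p' j\<bar> \<le> d" for j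
    using track stick_breaking_pos[of u j] u d by (cases "j < n") (auto simp: tracks_def p'_def space_sticks)
  ultimately have "\<bar>kth_largest (stick_breaking u) k - p' k\<bar> \<le> d"
    by (intro kth_largest_near_decseq)
  then show ?thesis using k by (simp add: p'_def)
qed

text \<open>
  If the first \<open>n\<close> pieces track \<open>p\<close> and the others are small, the
  unordered sequence is uniformly close to \<open>p\<close> cut off after \<open>n\<close> entries,
  and so is the ranked one, because ranking is nonexpansive and leaves the decreasing sequence
  alone. These pieces leave at least the length \<open>g\<close> for the others, where
  \<open>g\<close> falls short of \<open>1 - suminf p\<close> only by \<open>n * d\<close>, so the
  rate \<open>- ln g\<close> can be brought close to \<open>S p\<close>.
\<close>

lemma PD_local_lower:
  assumes p: "p \<in> nabla" and M: "S p < ereal M" and U: "open U" "p \<in> U"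
  shows "\<forall>\<^sub>F \<theta> in at_top. exp (- (\<theta> * M)) \<le> measure (PD \<theta>) (U \<inter> nabla)"
proof -
  obtain n \<delta> where \<delta>: "0 < \<delta>" "\<And>q. (\<And>k. k < n \<Longrightarrow> \<bar>q k - p k\<bar> < \<delta>) \<Longrightarrow> q \<in> U"
    using open_contains_coordinate_box[OF U] by blast
  define gap where "gap = 1 - suminf p - exp (- M)"
  have gap: "0 < gap" using M S_less_iff[OF p] by (simp add: gap_def)
  \<comment> \<open>Small enough for the box, and \<open>n\<close> overshoots of size \<open>d\<close> still fit into the gap.\<close>
  define d where "d = min (\<delta> / 2) (gap / (real n + 1))"
  have "0 < d" using \<delta>(1) gap by (simp add: d_def)
  moreover have "d \<le> \<delta> / 2" unfolding d_def by (rule min.cobounded1)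
  ultimately have d: "0 < d" "d < \<delta>" using \<delta>(1) by auto
  have "real n * d < gap"
  proof -
    have "d \<le> gap / (real n + 1)" unfolding d_def by (rule min.cobounded2)
    then have "(real n + 1) * d \<le> gap" by (simp add: pos_le_divide_eq mult.commute)
    then show ?thesis using d(1) by (simp add: algebra_simps)
  qed
  define g where "g = 1 - suminf p - real n * d"
  have g: "exp (- M) < g" using \<open>real n * d < gap\<close> by (simp add: g_def gap_def)
  have "0 < g" using less_trans[OF exp_gt_zero g] .
  have "0 \<le> suminf p" using p by (intro suminf_nonneg) (auto simp: nabla_def)
  moreover have "0 \<le> real n * d" using d(1) by simp
  ultimately have "g \<le> 1" by (simp add: g_def)
  have "- M < ln g" using g \<open>0 < g\<close> by (subst exp_less_cancel_iff[symmetric]) simp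
  then have "- ln g < M" by simp
  then have "\<forall>\<^sub>F \<theta> in at_top. 2 * exp (- (\<theta> * M)) \<le> exp (- (\<theta> * (- ln g)))"
    by (rule eventually_mult_exp_le_exp)
  then show ?thesis
    using eventually_all_sticks_small[OF d(1)] eventually_gt_at_top[of 1] eventually_ge_at_top[of "1 / d"]
  proof eventually_elim
    case (elim \<theta>)
    interpret prob_space "sticks \<theta>" by (rule prob_space_sticks) (use elim in simp)
    have head: "(\<Sum>k<n. p k) \<le> suminf p"
      using p by (intro sum_le_suminf) (auto simp: nabla_def)
    have "1 \<le> (\<theta> * d) ^ n" using elim d(1) by (intro one_le_power) (simp add: field_simps)
    have "exp (- (\<theta> * M)) \<le> 1 / 2 * 1 * g powr \<theta>"
      using elim \<open>0 < g\<close> by (simp add: powr_def)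
    also have "\<dots> \<le> 1 / 2 * (\<theta> * d) ^ n * (1 - ((\<Sum>k<n. p k) + real n * d)) powr (\<theta> - 1)"
    proof (intro mult_mono)
      have "g powr \<theta> \<le> g powr (\<theta> - 1)" using \<open>0 < g\<close> \<open>g \<le> 1\<close> by (intro powr_mono') auto
      also have "\<dots> \<le> (1 - ((\<Sum>k<n. p k) + real n * d)) powr (\<theta> - 1)"
        using \<open>0 < g\<close> elim head by (intro powr_mono2) (auto simp: g_def)
      finally show "g powr \<theta> \<le> (1 - ((\<Sum>k<n. p k) + real n * d)) powr (\<theta> - 1)" .
    qed (use \<open>1 \<le> (\<theta> * d) ^ n\<close> in auto)
    finally have "ennreal (exp (- (\<theta> * M)))
        \<le> ennreal (1 / 2 * (\<theta> * d) ^ n * ((1 - ((\<Sum>k<n. p k) + real n * d)) / 1) powr (\<theta> - 1))"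
      by (intro ennreal_leI) simp
    also have "\<dots> \<le> emeasure (sticks \<theta>) {u \<in> space (sticks \<theta>). tracks n p d 1 u}"
      using elim d p \<open>0 < g\<close> head
      by (intro emeasure_tracks_ge) (auto simp: nabla_def g_def)
    also have "\<dots> \<le> emeasure (sticks \<theta>) {u \<in> space (sticks \<theta>). kth_largest (stick_breaking u) \<in> U}"
    proof (intro emeasure_mono sets_kth_largest_open U(1) Collect_mono impI conjI)
      fix u assume u: "u \<in> space (sticks \<theta>) \<and> tracks n p d 1 u"
      then show "u \<in> space (sticks \<theta>)" by blast
      show "kth_largest (stick_breaking u) \<in> U"
      proof (rule \<delta>(2))
        fix k assume "k < n"
        then show "\<bar>kth_largest (stick_breaking u) k - p k\<bar> < \<delta>"
          using tracks_near[OF _ _ p _ d(1), of u \<theta> n k] u d(2) by linarith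
      qed
    qed
    finally show ?case unfolding measure_PD_open[OF U(1)] emeasure_eq_measure by simp
  qed
qed

lemma has_local_rate_PD: "has_local_rate nabla PD S"
  unfolding has_local_rate_def using PD_local_upper PD_local_lower by blast

section \<open>Tilting\<close>

lemma H_measurable [measurable]: "H \<in> borel_measurable (PD \<theta>)"
  unfolding measurable_cong_sets[OF sets_PD refl]
  by (rule borel_measurable_continuous_on_restrict[OF continuous_on_H])

definition normaliser :: "real \<Rightarrow> real \<Rightarrow> real" where
  "normaliser a \<theta> = (\<integral>q. exp (a * H q) \<partial>PD \<theta>)"

lemma mult_H_le_abs:
  assumes "q \<in> nabla"
  shows "\<bar>a * H q\<bar> \<le> \<bar>a\<bar>"
proof -
  have "\<bar>H q\<bar> \<le> 1" using H_le_0[OF assms] H_ge_minus_1[OF assms] by simp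
  then have "\<bar>a\<bar> * \<bar>H q\<bar> \<le> \<bar>a\<bar> * 1" by (intro mult_left_mono) auto
  then show ?thesis by (simp add: abs_mult)
qed

lemma integrable_exp_H:
  assumes "0 < \<theta>"
  shows "integrable (PD \<theta>) (\<lambda>q. exp (a * H q))"
proof -
  interpret prob_space "PD \<theta>" by (rule prob_space_PD[OF assms])
  have "exp (a * H q) \<le> exp \<bar>a\<bar>" if "q \<in> nabla" for q
    using mult_H_le_abs[OF that, of a] by simp
  then show ?thesis
    by (intro integrable_const_bound[of _ "exp \<bar>a\<bar>"]) (auto simp: space_PD)
qed

lemma normaliser_pos:
  assumes "0 < \<theta>"
  shows "0 < normaliser a \<theta>"
proof -
  interpret prob_space "PD \<theta>" by (rule prob_space_PD[OF assms])
  have "exp (- \<bar>a\<bar>) \<le> normaliser a \<theta>"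
    unfolding normaliser_def
  proof (rule integral_ge_const[OF integrable_exp_H[OF assms]], rule AE_I2)
    fix q assume "q \<in> space (PD \<theta>)"
    then show "exp (- \<bar>a\<bar>) \<le> exp (a * H q)" using mult_H_le_abs[of q a] by (simp add: space_PD)
  qed
  then show ?thesis using less_le_trans[OF exp_gt_zero] by blast
qed

lemma normaliser_le:
  assumes \<theta>: "0 < \<theta>" and B: "\<And>q. q \<in> nabla \<Longrightarrow> a * H q \<le> B"
  shows "normaliser a \<theta> \<le> exp B"
proof -
  interpret prob_space "PD \<theta>" by (rule prob_space_PD[OF \<theta>])
  show ?thesis
    unfolding normaliser_def
    by (rule integral_le_const[OF integrable_exp_H[OF \<theta>]], rule AE_I2) (simp add: space_PD B)
qed

lemma sets_PD_H: "sets (PD_H a \<theta>) = sets (restrict_space borel nabla)"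
  by (simp add: PD_H_def sets_PD)

lemma emeasure_PD_H:
  assumes "A \<in> sets (PD \<theta>)"
  shows "emeasure (PD_H a \<theta>) A
    = (\<integral>\<^sup>+q. ennreal (exp (a * H q) / normaliser a \<theta>) * indicator A q \<partial>PD \<theta>)"
  unfolding PD_H_def normaliser_def[symmetric] using assms by (intro emeasure_density) measurable

lemma prob_space_PD_H:
  assumes "0 < \<theta>"
  shows "prob_space (PD_H a \<theta>)"
proof
  have "emeasure (PD_H a \<theta>) (space (PD_H a \<theta>)) = emeasure (PD_H a \<theta>) (space (PD \<theta>))"
    by (simp add: PD_H_def)
  also have "\<dots> = (\<integral>\<^sup>+q. ennreal (exp (a * H q) / normaliser a \<theta>) * indicator (space (PD \<theta>)) q \<partial>PD \<theta>)"
    by (rule emeasure_PD_H) simp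
  also have "\<dots> = (\<integral>\<^sup>+q. ennreal (exp (a * H q) / normaliser a \<theta>) \<partial>PD \<theta>)"
    by (intro nn_integral_cong) simp
  also have "\<dots> = ennreal (\<integral>q. exp (a * H q) / normaliser a \<theta> \<partial>PD \<theta>)"
    using integrable_exp_H[OF assms] normaliser_pos[OF assms, of a]
    by (intro nn_integral_eq_integral) auto
  also have "\<dots> = 1"
    using normaliser_pos[OF assms, of a] by (simp add: normaliser_def[symmetric])
  finally show "emeasure (PD_H a \<theta>) (space (PD_H a \<theta>)) = 1" .
qed

lemma measure_PD_H_le:
  assumes \<theta>: "0 < \<theta>" and A: "A \<in> sets (PD \<theta>)" and B: "\<And>q. q \<in> A \<Longrightarrow> a * H q \<le> B"
  shows "measure (PD_H a \<theta>) A \<le> exp B / normaliser a \<theta> * measure (PD \<theta>) A"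
proof -
  interpret prob_space "PD \<theta>" by (rule prob_space_PD[OF \<theta>])
  interpret tilted: prob_space "PD_H a \<theta>" by (rule prob_space_PD_H[OF \<theta>])
  have Z: "0 < normaliser a \<theta>" by (rule normaliser_pos[OF \<theta>])
  have "ennreal (measure (PD_H a \<theta>) A)
      = (\<integral>\<^sup>+q. ennreal (exp (a * H q) / normaliser a \<theta>) * indicator A q \<partial>PD \<theta>)"
    unfolding tilted.emeasure_eq_measure[symmetric] by (rule emeasure_PD_H[OF A])
  also have "\<dots> \<le> (\<integral>\<^sup>+q. ennreal (exp B / normaliser a \<theta>) * indicator A q \<partial>PD \<theta>)"
    using B Z
    by (intro nn_integral_mono) (auto simp: indicator_def intro!: ennreal_leI divide_right_mono)
  also have "\<dots> = ennreal (exp B / normaliser a \<theta> * measure (PD \<theta>) A)"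
    using A Z by (simp add: nn_integral_cmult_indicator emeasure_eq_measure ennreal_mult'[symmetric])
  finally show ?thesis using Z by (subst (asm) ennreal_le_iff) auto
qed

lemma measure_PD_H_ge:
  assumes \<theta>: "0 < \<theta>" and A: "A \<in> sets (PD \<theta>)" and B: "\<And>q. q \<in> A \<Longrightarrow> B \<le> a * H q"
  shows "exp B / normaliser a \<theta> * measure (PD \<theta>) A \<le> measure (PD_H a \<theta>) A"
proof -
  interpret prob_space "PD \<theta>" by (rule prob_space_PD[OF \<theta>])
  interpret tilted: prob_space "PD_H a \<theta>" by (rule prob_space_PD_H[OF \<theta>])
  have Z: "0 < normaliser a \<theta>" by (rule normaliser_pos[OF \<theta>])
  have "ennreal (exp B / normaliser a \<theta> * measure (PD \<theta>) A)
      = (\<integral>\<^sup>+q. ennreal (exp B / normaliser a \<theta>) * indicator A q \<partial>PD \<theta>)"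
    using A Z by (simp add: nn_integral_cmult_indicator emeasure_eq_measure ennreal_mult'[symmetric])
  also have "\<dots> \<le> (\<integral>\<^sup>+q. ennreal (exp (a * H q) / normaliser a \<theta>) * indicator A q \<partial>PD \<theta>)"
    using B Z
    by (intro nn_integral_mono) (auto simp: indicator_def intro!: ennreal_leI divide_right_mono)
  also have "\<dots> = ennreal (measure (PD_H a \<theta>) A)"
    unfolding tilted.emeasure_eq_measure[symmetric] by (rule emeasure_PD_H[OF A, symmetric])
  finally show ?thesis by (subst (asm) ennreal_le_iff) auto
qed

lemma H_neighbourhood:
  assumes "p \<in> nabla" "0 < \<epsilon>"
  obtains V where "open V" "p \<in> V" "\<And>q. q \<in> V \<inter> nabla \<Longrightarrow> \<bar>H q - H p\<bar> < \<epsilon>"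
proof -
  have "\<exists>V. open V \<and> p \<in> V \<and> (\<forall>q\<in>nabla. q \<in> V \<longrightarrow> H q \<in> ball (H p) \<epsilon>)"
    using continuous_on_H assms unfolding continuous_on_topological
    by (meson centre_in_ball open_ball)
  then obtain V where "open V" "p \<in> V" "\<forall>q\<in>nabla. q \<in> V \<longrightarrow> H q \<in> ball (H p) \<epsilon>" by blast
  then show ?thesis by (intro that[of V]) (auto simp: dist_real_def abs_minus_commute)
qed

lemma S_zero: "S (\<lambda>_. 0) = 0"
  by (simp add: S_def zero_ereal_def)

text \<open>
  The measure \<open>PD \<theta>\<close> gives every neighbourhood of the zero sequence, where
  \<open>H\<close> attains its maximum \<open>0\<close>, a mass of exponential rate \<open>S 0 =
  0\<close>. Hence the normalising constant costs nothing on the scale of \<open>\<theta>\<close>.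
  The two tolerances are separate so that \<open>\<alpha>\<close> may grow faster than
  \<open>\<theta>\<close>.
\<close>

lemma eventually_normaliser_ge:
  assumes \<epsilon>: "0 < \<epsilon>" "0 < \<eta>"
  shows "\<forall>\<^sub>F \<theta> in at_top. exp (- (\<bar>\<alpha> \<theta>\<bar> * \<eta> + \<theta> * \<epsilon>)) \<le> normaliser (\<alpha> \<theta>) \<theta>"
proof -
  obtain V where V: "open V" "(\<lambda>_. 0) \<in> V" "\<And>q. q \<in> V \<inter> nabla \<Longrightarrow> \<bar>H q - H (\<lambda>_. 0)\<bar> < \<eta>"
    using H_neighbourhood[OF zero_in_nabla \<epsilon>(2)] by metis
  have "\<forall>\<^sub>F \<theta> in at_top. exp (- (\<theta> * \<epsilon>)) \<le> measure (PD \<theta>) (V \<inter> nabla)"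
    by (rule has_local_rateD_lower[OF has_local_rate_PD zero_in_nabla _ V(1,2)])
      (use \<epsilon> in \<open>simp add: S_zero\<close>)
  then show ?thesis
    using eventually_gt_at_top[of 0]
  proof eventually_elim
    case (elim \<theta>)
    interpret tilted: prob_space "PD_H (\<alpha> \<theta>) \<theta>" by (rule prob_space_PD_H) (use elim in simp)
    have Z: "0 < normaliser (\<alpha> \<theta>) \<theta>" by (rule normaliser_pos) (use elim in simp)
    have "- (\<bar>\<alpha> \<theta>\<bar> * \<eta>) \<le> \<alpha> \<theta> * H q" if "q \<in> V \<inter> nabla" for q
    proof -
      have "\<bar>\<alpha> \<theta> * H q\<bar> \<le> \<bar>\<alpha> \<theta>\<bar> * \<eta>"
        unfolding abs_mult using V(3)[OF that] by (intro mult_left_mono) auto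
      then show ?thesis by simp
    qed
    then have "exp (- (\<bar>\<alpha> \<theta>\<bar> * \<eta>)) / normaliser (\<alpha> \<theta>) \<theta> * measure (PD \<theta>) (V \<inter> nabla)
        \<le> measure (PD_H (\<alpha> \<theta>) \<theta>) (V \<inter> nabla)"
      using elim by (intro measure_PD_H_ge open_Int_nabla_in_sets_PD V) auto
    also have "\<dots> \<le> 1" by (rule tilted.prob_le_1)
    finally have "exp (- (\<bar>\<alpha> \<theta>\<bar> * \<eta>)) * measure (PD \<theta>) (V \<inter> nabla) \<le> normaliser (\<alpha> \<theta>) \<theta>"
      using Z by (simp add: field_simps)
    moreover have "exp (- (\<bar>\<alpha> \<theta>\<bar> * \<eta>)) * exp (- (\<theta> * \<epsilon>))
        \<le> exp (- (\<bar>\<alpha> \<theta>\<bar> * \<eta>)) * measure (PD \<theta>) (V \<inter> nabla)"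
      using elim by (intro mult_left_mono) auto
    ultimately show ?case by (simp add: exp_add[symmetric] algebra_simps)
  qed
qed

lemma eventually_near_linear:
  assumes lim: "((\<lambda>\<theta>. ereal (\<alpha> \<theta> / \<theta>)) \<longlongrightarrow> ereal c) at_top" and \<epsilon>: "0 < \<epsilon>"
  shows "\<forall>\<^sub>F \<theta> in at_top. \<bar>\<alpha> \<theta> - c * \<theta>\<bar> \<le> \<epsilon> * \<theta>"
proof -
  have "((\<lambda>\<theta>. \<alpha> \<theta> / \<theta>) \<longlongrightarrow> c) at_top" using lim by (simp add: lim_ereal)
  then have "\<forall>\<^sub>F \<theta> in at_top. dist (\<alpha> \<theta> / \<theta>) c < \<epsilon>" using \<epsilon> by (rule tendstoD)
  then show ?thesis
    using eventually_gt_at_top[of 0]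
  proof eventually_elim
    case (elim \<theta>)
    have "\<alpha> \<theta> - c * \<theta> = (\<alpha> \<theta> / \<theta> - c) * \<theta>" using elim by (simp add: field_simps)
    then have "\<bar>\<alpha> \<theta> - c * \<theta>\<bar> = \<bar>\<alpha> \<theta> / \<theta> - c\<bar> * \<theta>"
      using elim by (simp only: abs_mult abs_of_pos)
    also have "\<dots> \<le> \<epsilon> * \<theta>"
      using elim by (intro mult_right_mono) (auto simp: dist_real_def)
    finally show ?case .
  qed
qed

lemma near_linear_mult_H:
  assumes near: "\<bar>a - c * \<theta>\<bar> \<le> \<epsilon> * \<theta>" and q: "q \<in> nabla"
  shows "\<bar>a * H q - c * \<theta> * H q\<bar> \<le> \<epsilon> * \<theta>"
proof -
  have "\<bar>a * H q - c * \<theta> * H q\<bar> = \<bar>(a - c * \<theta>) * H q\<bar>" by (simp add: left_diff_distrib)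
  also have "\<dots> \<le> \<epsilon> * \<theta>" using mult_H_le_abs[OF q] near by (rule order_trans)
  finally show ?thesis .
qed

text \<open>
  Near \<open>p\<close> the density of the tilted measure is \<open>exp (c * \<theta> * H p)\<close>
  up to an error of small exponential rate, since \<open>H\<close> is continuous and \<open>\<alpha>
  \<theta>\<close> is close to \<open>c * \<theta>\<close>; so the local rate \<open>S p\<close> is
  shifted by \<open>- c * H p\<close>.
\<close>

lemma PD_H_local_upper_finite:
  assumes c: "0 \<le> c" and lim: "((\<lambda>\<theta>. ereal (\<alpha> \<theta> / \<theta>)) \<longlongrightarrow> ereal c) at_top"
    and p: "p \<in> nabla" and M: "ereal (M + c * H p) < S p"
  shows "\<exists>U. open U \<and> p \<in> U \<and>
    (\<forall>\<^sub>F \<theta> in at_top. measure (PD_H (\<alpha> \<theta>) \<theta>) (U \<inter> nabla) \<le> exp (- (\<theta> * M)))"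
proof -
  obtain K where K: "ereal (M + c * H p) < ereal K" "ereal K < S p" using ereal_dense2[OF M] by blast
  \<comment> \<open>The tilt costs \<open>(c + 1) * \<epsilon>\<close> and the normalising constant \<open>(c + 2) * \<epsilon>\<close>.\<close>
  define \<epsilon> where "\<epsilon> = min 1 ((K - (M + c * H p)) / (2 * c + 3))"
  have \<epsilon>: "0 < \<epsilon>" "\<epsilon> \<le> 1" using K c by (auto simp: \<epsilon>_def)
  have "\<epsilon> \<le> (K - (M + c * H p)) / (2 * c + 3)" unfolding \<epsilon>_def by (rule min.cobounded2)
  then have gap: "\<epsilon> * (2 * c + 3) \<le> K - (M + c * H p)" using c by (simp add: pos_le_divide_eq)
  obtain W where W: "open W" "p \<in> W"
    "\<forall>\<^sub>F \<theta> in at_top. measure (PD \<theta>) (W \<inter> nabla) \<le> exp (- (\<theta> * K))"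
    using has_local_rateD_upper[OF has_local_rate_PD, OF p K(2)] by blast
  obtain V where V: "open V" "p \<in> V" "\<And>q. q \<in> V \<inter> nabla \<Longrightarrow> \<bar>H q - H p\<bar> < \<epsilon>"
    using H_neighbourhood[OF p \<epsilon>(1)] by metis
  have "\<forall>\<^sub>F \<theta> in at_top. measure (PD_H (\<alpha> \<theta>) \<theta>) ((W \<inter> V) \<inter> nabla) \<le> exp (- (\<theta> * M))"
    using W(3) eventually_normaliser_ge[OF \<epsilon>(1) \<epsilon>(1), of \<alpha>] eventually_near_linear[OF lim \<epsilon>(1)]
      eventually_gt_at_top[of 0]
  proof eventually_elim
    case (elim \<theta>)
    interpret prob_space "PD \<theta>" by (rule prob_space_PD) (use elim in simp)
    define B where "B = \<theta> * (c * H p + c * \<epsilon> + \<epsilon>)"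
    have B: "\<alpha> \<theta> * H q \<le> B" if q: "q \<in> (W \<inter> V) \<inter> nabla" for q
    proof -
      have "\<alpha> \<theta> * H q \<le> c * \<theta> * H q + \<epsilon> * \<theta>"
        using near_linear_mult_H[OF elim(3), of q] q by (simp add: abs_le_iff)
      moreover have "c * \<theta> * H q \<le> c * \<theta> * (H p + \<epsilon>)"
        using V(3)[of q] q c elim by (intro mult_left_mono) auto
      ultimately show ?thesis by (simp add: B_def algebra_simps)
    qed
    have Z: "exp (- (\<theta> * ((c + 2) * \<epsilon>))) \<le> normaliser (\<alpha> \<theta>) \<theta>"
    proof (rule order_trans[OF _ elim(2)])
      have "c * \<theta> \<ge> 0" using c elim by simp
      then have "\<bar>\<alpha> \<theta>\<bar> \<le> c * \<theta> + \<epsilon> * \<theta>" using elim(3) by linarith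
      also have "\<dots> \<le> (c + 1) * \<theta>" using \<epsilon> elim by (simp add: distrib_right)
      finally have "\<bar>\<alpha> \<theta>\<bar> * \<epsilon> \<le> (c + 1) * \<theta> * \<epsilon>" using \<epsilon> by (intro mult_right_mono) auto
      then show "exp (- (\<theta> * ((c + 2) * \<epsilon>))) \<le> exp (- (\<bar>\<alpha> \<theta>\<bar> * \<epsilon> + \<theta> * \<epsilon>))"
        by (simp add: algebra_simps)
    qed
    have "measure (PD_H (\<alpha> \<theta>) \<theta>) ((W \<inter> V) \<inter> nabla)
        \<le> exp B / normaliser (\<alpha> \<theta>) \<theta> * measure (PD \<theta>) ((W \<inter> V) \<inter> nabla)"
      using elim B by (intro measure_PD_H_le open_Int_nabla_in_sets_PD open_Int W(1) V(1)) auto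
    also have "\<dots> \<le> exp B / exp (- (\<theta> * ((c + 2) * \<epsilon>))) * exp (- (\<theta> * K))"
    proof (intro mult_mono divide_left_mono Z)
      have "measure (PD \<theta>) ((W \<inter> V) \<inter> nabla) \<le> measure (PD \<theta>) (W \<inter> nabla)"
        by (intro finite_measure_mono open_Int_nabla_in_sets_PD W(1)) auto
      then show "measure (PD \<theta>) ((W \<inter> V) \<inter> nabla) \<le> exp (- (\<theta> * K))" using elim(1) by linarith
    qed (use normaliser_pos[OF elim(4)] in auto)
    also have "\<dots> = exp (- (\<theta> * (K - c * H p - \<epsilon> * (2 * c + 3))))"
      by (simp add: B_def exp_diff[symmetric] exp_add[symmetric] exp_minus[symmetric] algebra_simps)
    also have "\<dots> \<le> exp (- (\<theta> * M))"
      using gap elim(4) by (simp add: mult_left_mono)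
    finally show ?case .
  qed
  then show ?thesis using W(1,2) V(1,2) by (intro exI[of _ "W \<inter> V"]) auto
qed

lemma PD_H_local_lower_finite:
  assumes c: "0 \<le> c" and lim: "((\<lambda>\<theta>. ereal (\<alpha> \<theta> / \<theta>)) \<longlongrightarrow> ereal c) at_top"
    and p: "p \<in> nabla" and M: "S p < ereal (M + c * H p)" and U: "open U" "p \<in> U"
  shows "\<forall>\<^sub>F \<theta> in at_top. exp (- (\<theta> * M)) \<le> measure (PD_H (\<alpha> \<theta>) \<theta>) (U \<inter> nabla)"
proof -
  obtain K where K: "S p < ereal K" "ereal K < ereal (M + c * H p)" using ereal_dense2[OF M] by blast
  \<comment> \<open>The tilt costs \<open>(c + 1) * \<epsilon>\<close> and the normalising constant \<open>\<epsilon>\<close>.\<close>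
  define \<epsilon> where "\<epsilon> = (M + c * H p - K) / (c + 2)"
  have \<epsilon>: "0 < \<epsilon>" using K c by (simp add: \<epsilon>_def)
  have gap: "\<epsilon> * (c + 2) = M + c * H p - K" using c by (simp add: \<epsilon>_def)
  obtain V where V: "open V" "p \<in> V" "\<And>q. q \<in> V \<inter> nabla \<Longrightarrow> \<bar>H q - H p\<bar> < \<epsilon>"
    using H_neighbourhood[OF p \<epsilon>] by metis
  have "\<forall>\<^sub>F \<theta> in at_top. exp (- (\<theta> * K)) \<le> measure (PD \<theta>) ((U \<inter> V) \<inter> nabla)"
    using U V by (intro has_local_rateD_lower[OF has_local_rate_PD, OF p K(1)]) auto
  then show ?thesis
    using eventually_near_linear[OF lim \<epsilon>] eventually_gt_at_top[of 0]
  proof eventually_elim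
    case (elim \<theta>)
    interpret tilted: prob_space "PD_H (\<alpha> \<theta>) \<theta>" by (rule prob_space_PD_H) (use elim in simp)
    define B where "B = \<theta> * (c * H p - c * \<epsilon> - \<epsilon>)"
    have B: "B \<le> \<alpha> \<theta> * H q" if q: "q \<in> (U \<inter> V) \<inter> nabla" for q
    proof -
      have "c * \<theta> * H q - \<epsilon> * \<theta> \<le> \<alpha> \<theta> * H q"
        using near_linear_mult_H[OF elim(2), of q] q by (simp add: abs_le_iff)
      moreover have "c * \<theta> * (H p - \<epsilon>) \<le> c * \<theta> * H q"
        using V(3)[of q] q c elim by (intro mult_left_mono) auto
      ultimately show ?thesis by (simp add: B_def algebra_simps)
    qed
    have Z: "normaliser (\<alpha> \<theta>) \<theta> \<le> exp (\<epsilon> * \<theta>)"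
    proof (rule normaliser_le[OF elim(3)])
      fix q assume q: "q \<in> nabla"
      have "c * \<theta> * H q \<le> 0" using c elim H_le_0[OF q] by (intro mult_nonneg_nonpos) auto
      then show "\<alpha> \<theta> * H q \<le> \<epsilon> * \<theta>"
        using near_linear_mult_H[OF elim(2) q] by (simp add: abs_le_iff)
    qed
    have "exp (- (\<theta> * M)) = exp B / exp (\<epsilon> * \<theta>) * exp (- (\<theta> * K))"
    proof -
      have "- (\<theta> * M) = B - \<epsilon> * \<theta> - \<theta> * K"
        using arg_cong[OF gap, of "\<lambda>x. \<theta> * x"] by (simp add: B_def algebra_simps)
      then have "exp (- (\<theta> * M)) = exp (B - \<epsilon> * \<theta> + - (\<theta> * K))" by simp
      then show ?thesis by (simp only: exp_add exp_diff)
    qed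
    also have "\<dots> \<le> exp B / normaliser (\<alpha> \<theta>) \<theta> * measure (PD \<theta>) ((U \<inter> V) \<inter> nabla)"
      using elim normaliser_pos[OF elim(3), of "\<alpha> \<theta>"] by (intro mult_mono divide_left_mono Z) auto
    also have "\<dots> \<le> measure (PD_H (\<alpha> \<theta>) \<theta>) ((U \<inter> V) \<inter> nabla)"
      using elim B by (intro measure_PD_H_ge open_Int_nabla_in_sets_PD open_Int U(1) V(1)) auto
    also have "\<dots> \<le> measure (PD_H (\<alpha> \<theta>) \<theta>) (U \<inter> nabla)"
      using open_Int_nabla_in_sets_PD[OF U(1), of \<theta>]
      by (intro tilted.finite_measure_mono) (auto simp: sets_PD_H sets_PD)
    finally show ?case .
  qed
qed

lemma has_local_rate_PD_H_finite:
  assumes c: "0 \<le> c" and lim: "((\<lambda>\<theta>. ereal (\<alpha> \<theta> / \<theta>)) \<longlongrightarrow> ereal c) at_top"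
    and I: "\<And>p. p \<in> nabla \<Longrightarrow> I p = S p - ereal (c * H p)"
  shows "has_local_rate nabla (\<lambda>\<theta>. PD_H (\<alpha> \<theta>) \<theta>) I"
  unfolding has_local_rate_def
proof (intro ballI allI conjI impI)
  fix p M assume p: "p \<in> nabla"
  {
    assume "ereal M < I p"
    then have "ereal (M + c * H p) < S p" using I[OF p] by (cases "S p") auto
    then show "\<exists>U. open U \<and> p \<in> U \<and>
        (\<forall>\<^sub>F \<theta> in at_top. measure (PD_H (\<alpha> \<theta>) \<theta>) (U \<inter> nabla) \<le> exp (- (\<theta> * M)))"
      by (rule PD_H_local_upper_finite[OF c lim p])
  next
    fix U assume "I p < ereal M" and U: "open U" "p \<in> U"
    then have "S p < ereal (M + c * H p)" using I[OF p] by (cases "S p") auto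
    then show "\<forall>\<^sub>F \<theta> in at_top. exp (- (\<theta> * M)) \<le> measure (PD_H (\<alpha> \<theta>) \<theta>) (U \<inter> nabla)"
      by (rule PD_H_local_lower_finite[OF c lim p _ U])
  }
qed

text \<open>
  Away from the maximum of \<open>H\<close> the tilt gives \<open>exp (- (\<alpha> \<theta> *
  \<eta>))\<close>, of which the normalising constant can take back at most one half and a factor
  \<open>exp \<theta>\<close>; the remaining half beats every rate because \<open>\<alpha> \<theta>
  / \<theta>\<close> tends to infinity.
\<close>

lemma PD_H_superexponential:
  assumes lim: "((\<lambda>\<theta>. ereal (\<alpha> \<theta> / \<theta>)) \<longlongrightarrow> \<infinity>) at_top"
    and A: "\<And>\<theta>. A \<in> sets (PD \<theta>)" and \<eta>: "0 < \<eta>" "\<And>q. q \<in> A \<Longrightarrow> H q \<le> - \<eta>"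
  shows "\<forall>\<^sub>F \<theta> in at_top. measure (PD_H (\<alpha> \<theta>) \<theta>) A \<le> exp (- (\<theta> * M))"
proof -
  have "\<forall>\<^sub>F \<theta> in at_top. ereal (max 0 (2 * (M + 1) / \<eta>)) < ereal (\<alpha> \<theta> / \<theta>)"
    using lim by (simp only: tendsto_PInfty)
  then show ?thesis
    using eventually_normaliser_ge[of 1 "\<eta> / 2" \<alpha>, OF zero_less_one half_gt_zero[OF \<eta>(1)]]
      eventually_gt_at_top[of 0]
  proof eventually_elim
    case (elim \<theta>)
    interpret prob_space "PD \<theta>" by (rule prob_space_PD) (use elim in simp)
    have "0 < \<alpha> \<theta> / \<theta>" "2 * (M + 1) / \<eta> < \<alpha> \<theta> / \<theta>" using elim(1) by auto
    then have \<alpha>: "0 < \<alpha> \<theta>" "2 * (M + 1) * \<theta> < \<alpha> \<theta> * \<eta>"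
      using elim(3) \<eta>(1) by (auto simp: field_simps zero_less_mult_iff)
    have "measure (PD_H (\<alpha> \<theta>) \<theta>) A \<le> exp (- (\<alpha> \<theta> * \<eta>)) / normaliser (\<alpha> \<theta>) \<theta> * measure (PD \<theta>) A"
    proof (rule measure_PD_H_le[OF elim(3) A])
      fix q assume "q \<in> A"
      then have "\<alpha> \<theta> * H q \<le> \<alpha> \<theta> * (- \<eta>)" using \<eta>(2) \<alpha>(1) by (intro mult_left_mono) auto
      then show "\<alpha> \<theta> * H q \<le> - (\<alpha> \<theta> * \<eta>)" by simp
    qed
    also have "\<dots> \<le> exp (- (\<alpha> \<theta> * \<eta>)) / exp (- (\<bar>\<alpha> \<theta>\<bar> * (\<eta> / 2) + \<theta> * 1)) * 1"
      using normaliser_pos[OF elim(3), of "\<alpha> \<theta>"] by (intro mult_mono divide_left_mono elim(2) prob_le_1) auto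
    also have "\<dots> = exp (\<theta> - \<alpha> \<theta> * \<eta> / 2)"
      using \<alpha>(1) by (simp add: exp_diff[symmetric])
    also have "\<dots> \<le> exp (- (\<theta> * M))"
      using \<alpha>(2) by (simp add: algebra_simps)
    finally show ?case .
  qed
qed

text \<open>
  The lower estimate at the zero sequence is the upper estimate on the complement of its
  neighbourhood, on which \<open>H\<close> is bounded away from \<open>0\<close> by compactness.
\<close>

lemma has_local_rate_PD_H_infinite:
  assumes lim: "((\<lambda>\<theta>. ereal (\<alpha> \<theta> / \<theta>)) \<longlongrightarrow> \<infinity>) at_top"
  shows "has_local_rate nabla (\<lambda>\<theta>. PD_H (\<alpha> \<theta>) \<theta>) S_inf"
  unfolding has_local_rate_def
proof (intro ballI allI conjI impI)
  fix p M assume p: "p \<in> nabla"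
  {
    assume M: "ereal M < S_inf p"
    show "\<exists>U. open U \<and> p \<in> U \<and>
        (\<forall>\<^sub>F \<theta> in at_top. measure (PD_H (\<alpha> \<theta>) \<theta>) (U \<inter> nabla) \<le> exp (- (\<theta> * M)))"
    proof (cases "p = (\<lambda>_. 0)")
      case True
      then have "M < 0" using M by (simp add: S_inf_def)
      have "\<forall>\<^sub>F \<theta> in at_top. measure (PD_H (\<alpha> \<theta>) \<theta>) (UNIV \<inter> nabla) \<le> exp (- (\<theta> * M))"
        using eventually_gt_at_top[of 0]
      proof eventually_elim
        case (elim \<theta>)
        interpret tilted: prob_space "PD_H (\<alpha> \<theta>) \<theta>" by (rule prob_space_PD_H[OF elim])
        have "measure (PD_H (\<alpha> \<theta>) \<theta>) (UNIV \<inter> nabla) \<le> 1" by (rule tilted.prob_le_1)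
        also have "1 \<le> exp (- (\<theta> * M))" using elim \<open>M < 0\<close> by (simp add: mult_nonneg_nonpos)
        finally show ?case .
      qed
      then show ?thesis by (intro exI[of _ UNIV]) simp
    next
      case False
      define \<eta> where "\<eta> = - H p / 2"
      have \<eta>: "0 < \<eta>" using H_neg[OF p False] by (simp add: \<eta>_def)
      obtain V where V: "open V" "p \<in> V" "\<And>q. q \<in> V \<inter> nabla \<Longrightarrow> \<bar>H q - H p\<bar> < \<eta>"
        using H_neighbourhood[OF p \<eta>] by metis
      have "H q \<le> - \<eta>" if "q \<in> V \<inter> nabla" for q
        using V(3)[OF that] by (simp add: \<eta>_def abs_less_iff)
      then have "\<forall>\<^sub>F \<theta> in at_top. measure (PD_H (\<alpha> \<theta>) \<theta>) (V \<inter> nabla) \<le> exp (- (\<theta> * M))"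
        by (intro PD_H_superexponential[OF lim _ \<eta>] open_Int_nabla_in_sets_PD V)
      then show ?thesis using V by blast
    qed
  next
    fix U assume "S_inf p < ereal M" and U: "open U" "p \<in> U"
    then have "p = (\<lambda>_. 0)" and M: "0 < M"
      by (auto simp: S_inf_def zero_ereal_def split: if_splits)
    have "\<exists>\<eta>>0. \<forall>q\<in>nabla - U. H q \<le> - \<eta>"
    proof (cases "nabla - U = {}")
      case True
      then show ?thesis by (intro exI[of _ 1]) auto
    next
      case False
      have "compact (nabla - U)" using compact_nabla U(1) by (rule compact_diff)
      moreover have "continuous_on (nabla - U) H"
        by (rule continuous_on_subset[OF continuous_on_H]) blast
      ultimately obtain q where q: "q \<in> nabla - U" "\<And>r. r \<in> nabla - U \<Longrightarrow> H r \<le> H q"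
        using continuous_attains_sup[OF _ False] by blast
      have "q \<noteq> (\<lambda>_. 0)" using q(1) U(2) \<open>p = (\<lambda>_. 0)\<close> by auto
      then have "H q < 0" using q(1) by (intro H_neg) auto
      then show ?thesis using q(2) by (intro exI[of _ "- H q"]) auto
    qed
    then obtain \<eta> where \<eta>: "0 < \<eta>" "\<And>q. q \<in> nabla - U \<Longrightarrow> H q \<le> - \<eta>" by blast
    have A: "nabla - U \<in> sets (PD \<theta>)" for \<theta>
      using sets.compl_sets[OF open_Int_nabla_in_sets_PD[OF U(1), of \<theta>]]
      by (simp add: space_PD Diff_Int2 Diff_Int)
    have "\<forall>\<^sub>F \<theta> in at_top. measure (PD_H (\<alpha> \<theta>) \<theta>) (nabla - U) \<le> exp (- (\<theta> * M))"
      by (rule PD_H_superexponential[OF lim A \<eta>])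
    moreover have "\<forall>\<^sub>F \<theta> in at_top. 2 * exp (- (\<theta> * M)) \<le> exp (- (\<theta> * 0))"
      by (rule eventually_mult_exp_le_exp[OF M])
    ultimately show "\<forall>\<^sub>F \<theta> in at_top. exp (- (\<theta> * M)) \<le> measure (PD_H (\<alpha> \<theta>) \<theta>) (U \<inter> nabla)"
      using eventually_gt_at_top[of 0]
    proof eventually_elim
      case (elim \<theta>)
      interpret tilted: prob_space "PD_H (\<alpha> \<theta>) \<theta>" by (rule prob_space_PD_H[OF elim(3)])
      have space: "space (PD_H (\<alpha> \<theta>) \<theta>) = nabla" by (simp add: PD_H_def space_PD)
      have "measure (PD_H (\<alpha> \<theta>) \<theta>) (nabla - U \<inter> nabla) = 1 - measure (PD_H (\<alpha> \<theta>) \<theta>) (U \<inter> nabla)"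
        using open_Int_nabla_in_sets_PD[OF U(1), of \<theta>] tilted.prob_compl[of "U \<inter> nabla"]
        by (simp add: space sets_PD_H sets_PD)
      moreover have "nabla - U \<inter> nabla = nabla - U" by blast
      ultimately show ?case using elim by simp
    qed
  }
qed

text \<open>
  Both \<open>c * H\<close> and \<open>- S\<close> are at most \<open>0\<close> and vanish at the
  zero sequence, so the supremum in \<^const>\<open>S_fin\<close> is trivial.
\<close>

lemma SUP_tilt_eq_0:
  assumes "0 \<le> c"
  shows "(SUP q\<in>nabla. ereal (c * H q) - S q) = 0"
proof (rule antisym)
  show "(SUP q\<in>nabla. ereal (c * H q) - S q) \<le> 0"
  proof (rule SUP_least)
    fix q assume q: "q \<in> nabla"
    have "0 \<le> suminf q" using q by (intro suminf_nonneg) (auto simp: nabla_def)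
    then have "0 \<le> S q" by (auto simp: S_def ln_ge_zero)
    moreover have "c * H q \<le> 0" using assms H_le_0[OF q] by (rule mult_nonneg_nonpos)
    ultimately show "ereal (c * H q) - S q \<le> 0" by (cases "S q") auto
  qed
  have "ereal (c * H (\<lambda>_. 0)) - S (\<lambda>_. 0) \<le> (SUP q\<in>nabla. ereal (c * H q) - S q)"
    by (rule SUP_upper[OF zero_in_nabla])
  then show "0 \<le> (SUP q\<in>nabla. ereal (c * H q) - S q)"
    by (simp add: S_zero flip: zero_ereal_def)
qed

lemma S_fin_eq:
  assumes "0 \<le> c"
  shows "S_fin c p = S p - ereal (c * H p)"
  unfolding S_fin_def SUP_tilt_eq_0[OF assms] by (cases "S p") auto

lemma S_eq_minus_zero: "S p = S p - ereal (0 * H p)"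
  by (cases "S p") auto

lemma has_local_rate_PD_H:
  assumes lim: "((\<lambda>\<theta>. ereal (\<alpha> \<theta> / \<theta>)) \<longlongrightarrow> L) at_top"
    and L: "L = 0 \<or> (\<exists>c>0. L = ereal c) \<or> L = \<infinity>"
  shows "has_local_rate nabla (\<lambda>\<theta>. PD_H (\<alpha> \<theta>) \<theta>) (S_rate L)"
  using L
proof (elim disjE exE conjE)
  assume "L = 0"
  with lim show ?thesis
    using has_local_rate_PD_H_finite[of 0 \<alpha> S] S_eq_minus_zero
    by (simp add: S_rate_def zero_ereal_def)
next
  fix c :: real assume "0 < c" "L = ereal c"
  with lim show ?thesis
    using has_local_rate_PD_H_finite[of c \<alpha> "S_fin c"] S_fin_eq[of c]
    by (simp add: S_rate_def zero_ereal_def)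
next
  assume "L = \<infinity>"
  with lim show ?thesis
    using has_local_rate_PD_H_infinite[of \<alpha>] by (simp add: S_rate_def)
qed

theorem corollary5p1:
  fixes \<alpha> :: "real \<Rightarrow> real" and L :: ereal
  assumes "((\<lambda>\<theta>. ereal (\<alpha> \<theta> / \<theta>)) \<longlongrightarrow> L) at_top"
    and "L = 0 \<or> (\<exists>c>0. L = ereal c) \<or> L = \<infinity>"
  shows "satisfies_LDP nabla (\<lambda>\<theta>. PD_H (\<alpha> \<theta>) \<theta>) (S_rate L)
    \<and> (\<lambda>_. 0) \<in> nabla \<and> (\<forall>p\<in>nabla. p \<noteq> (\<lambda>_. 0) \<longrightarrow> H p < H (\<lambda>_. 0))"
proof (intro conjI ballI impI)
  show "satisfies_LDP nabla (\<lambda>\<theta>. PD_H (\<alpha> \<theta>) \<theta>) (S_rate L)"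
    by (rule LDP_of_local_rate[OF compact_nabla prob_space_PD_H sets_PD_H has_local_rate_PD_H[OF assms]])
  show "(\<lambda>_. 0) \<in> nabla" by (rule zero_in_nabla)
  show "H p < H (\<lambda>_. 0)" if "p \<in> nabla" "p \<noteq> (\<lambda>_. 0)" for p
    using H_neg[OF that] by (simp only: H_zero)
qed

end
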